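(* Let $K$ be any field and $\mathbf R=\operatorname{Lie}(v_0,v_1)=\mathbf R_{\bar 0}\oplus\mathbf R_{\bar 1}$ (even and odd components). For any $a\in\mathbf R_{\bar n}$, $\bar n\in\{\bar 0,\bar 1\}$, the operator $\operatorname{ad}(a):\mathbf R\to\mathbf R$, $b\mapsto[a,b]$, is nilpotent.
   Context: Let $\Lambda=\Lambda(x_i\mid i\ge 0)$ be the Grassmann (exterior) algebra over $K$ on odd generators $x_0,x_1,\dots$ ($x_ix_j=-x_jx_i$, $x_i^2=0$), a $\mathbb Z_2$-graded algebra; $\operatorname{End}\Lambda$ is then an associative superalgebra. Identify $x_i$ with left multiplication by $x_i$, and let $\partial_i$ be the odd superderivation of $\Lambda$ with $\partial_i(x_j)=\delta_{ij}$. The supercommutator is $[a,b]=ab-(-1)^{\deg a\deg b}ba$. The pivot elements are the odd superderivations $v_i=\partial_i+x_ix_{i+1}(\partial_{i+2}+x_{i+2}x_{i+3}(\partial_{i+4}+\cdots))$, $i\ge 0$, that is, $v_i=\partial_i+x_ix_{i+1}v_{i+2}$ (well defined on $\Lambda$, since each element involves finitely many letters). $\mathbf R=\operatorname{Lie}(v_0,v_1)$ is the smallest $\mathbb Z_2$-graded subspace of $\operatorname{End}\Lambda$ containing $v_0,v_1$, closed under the supercommutator and, if $\operatorname{char}K=2$, also under $a\mapsto a^2$ for odd elements $a$; $\mathbf R_{\bar 0},\mathbf R_{\bar1}$ are its even and odd parts. *)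

theory Defs
  imports Complex_Main
begin

section \<open>The Grassmann algebra on generators indexed by the naturals\<close>

text \<open>
  An element is given by its coefficients on the basis monomials
  \<open>x\<^sub>S = x\<^sub>s\<^sub>1 \<cdots> x\<^sub>s\<^sub>k\<close>, where \<open>S = {s\<^sub>1 < \<cdots> < s\<^sub>k}\<close> is a finite set of naturals.
\<close>

typedef (overloaded) 'a grassmann =
  "{f :: nat set \<Rightarrow> 'a::zero. finite {S. f S \<noteq> 0} \<and> (\<forall>S. f S \<noteq> 0 \<longrightarrow> finite S)}"
  morphisms coeff Abs_grassmann
  by (rule exI[of _ "\<lambda>_. 0"]) auto

setup_lifting type_definition_grassmann

lemma finite_coeff: "finite {S. coeff f S \<noteq> 0}"
  and coeff_infinite: "infinite S \<Longrightarrow> coeff f S = 0"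
  using coeff[of f] by auto

lemma grassmann_eqI:
  assumes "\<And>S. finite S \<Longrightarrow> coeff f S = coeff g S"
  shows "f = g"
proof -
  have "coeff f S = coeff g S" for S
    using assms[of S] by (cases "finite S") (simp_all add: coeff_infinite)
  then show ?thesis by (simp add: coeff_inject[symmetric] fun_eq_iff)
qed

text \<open>For disjoint \<open>S\<close> and \<open>T\<close>, sorting the concatenated word gives
  \<open>x\<^sub>S x\<^sub>T = ksign S T x\<^sub>S\<^sub>\<union>\<^sub>T\<close>.\<close>

definition ksign :: "nat set \<Rightarrow> nat set \<Rightarrow> 'a::ring_1" where
  "ksign S T = (- 1) ^ card {(s, t). s \<in> S \<and> t \<in> T \<and> t < s}"

lemma ksign_empty [simp]: "ksign {} T = 1" "ksign S {} = 1"
  by (simp_all add: ksign_def)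

lemma ksign_Un_left:
  assumes "finite S" "finite T" "finite U" "S \<inter> T = {}"
  shows "ksign (S \<union> T) U = ksign S U * (ksign T U :: 'a::ring_1)"
proof -
  have "{(s, t). s \<in> S \<union> T \<and> t \<in> U \<and> t < s} =
        {(s, t). s \<in> S \<and> t \<in> U \<and> t < s} \<union> {(s, t). s \<in> T \<and> t \<in> U \<and> t < s}" by auto
  moreover have "finite {(s, t). s \<in> S \<and> t \<in> U \<and> t < s}"
    by (rule finite_subset[of _ "S \<times> U"]) (use assms in auto)
  moreover have "finite {(s, t). s \<in> T \<and> t \<in> U \<and> t < s}"
    by (rule finite_subset[of _ "T \<times> U"]) (use assms in auto)
  ultimately show ?thesis
    unfolding ksign_def using assms(4)
    by (subst power_add[symmetric], subst card_Un_disjoint[symmetric]) auto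
qed

lemma ksign_Un_right:
  assumes "finite S" "finite T" "finite U" "S \<inter> T = {}"
  shows "ksign U (S \<union> T) = ksign U S * (ksign U T :: 'a::ring_1)"
proof -
  have "{(s, t). s \<in> U \<and> t \<in> S \<union> T \<and> t < s} =
        {(s, t). s \<in> U \<and> t \<in> S \<and> t < s} \<union> {(s, t). s \<in> U \<and> t \<in> T \<and> t < s}" by auto
  moreover have "finite {(s, t). s \<in> U \<and> t \<in> S \<and> t < s}"
    by (rule finite_subset[of _ "U \<times> S"]) (use assms in auto)
  moreover have "finite {(s, t). s \<in> U \<and> t \<in> T \<and> t < s}"
    by (rule finite_subset[of _ "U \<times> T"]) (use assms in auto)
  ultimately show ?thesis
    unfolding ksign_def using assms(4)
    by (subst power_add[symmetric], subst card_Un_disjoint[symmetric]) auto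
qed

instantiation grassmann :: (field) ring_1
begin

lift_definition zero_grassmann :: "'a grassmann" is "\<lambda>_. 0" by auto
lift_definition one_grassmann :: "'a grassmann" is "\<lambda>S. if S = {} then 1 else 0" by auto
lift_definition plus_grassmann :: "'a grassmann \<Rightarrow> 'a grassmann \<Rightarrow> 'a grassmann"
  is "\<lambda>f g S. f S + g S"
proof -
  fix f g :: "nat set \<Rightarrow> 'a"
  assume *: "finite {S. f S \<noteq> 0} \<and> (\<forall>S. f S \<noteq> 0 \<longrightarrow> finite S)"
    "finite {S. g S \<noteq> 0} \<and> (\<forall>S. g S \<noteq> 0 \<longrightarrow> finite S)"
  then have "finite ({S. f S \<noteq> 0} \<union> {S. g S \<noteq> 0})" by simp
  moreover have "{S. f S + g S \<noteq> 0} \<subseteq> {S. f S \<noteq> 0} \<union> {S. g S \<noteq> 0}" by auto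
  ultimately have "finite {S. f S + g S \<noteq> 0}" by (rule rev_finite_subset)
  moreover have "finite S" if "f S + g S \<noteq> 0" for S
    using that * by (cases "f S = 0") auto
  ultimately show "finite {S. f S + g S \<noteq> 0} \<and> (\<forall>S. f S + g S \<noteq> 0 \<longrightarrow> finite S)"
    by blast
qed
lift_definition uminus_grassmann :: "'a grassmann \<Rightarrow> 'a grassmann" is "\<lambda>f S. - f S" by simp
definition minus_grassmann :: "'a grassmann \<Rightarrow> 'a grassmann \<Rightarrow> 'a grassmann"
  where "minus_grassmann f g = f + (- g)"
lift_definition times_grassmann :: "'a grassmann \<Rightarrow> 'a grassmann \<Rightarrow> 'a grassmann"
  is "\<lambda>f g U. \<Sum>S\<in>Pow U. ksign S (U - S) * f S * g (U - S)"
proof -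
  fix f g :: "nat set \<Rightarrow> 'a"
  assume f: "finite {S. f S \<noteq> 0} \<and> (\<forall>S. f S \<noteq> 0 \<longrightarrow> finite S)"
    and g: "finite {S. g S \<noteq> 0} \<and> (\<forall>S. g S \<noteq> 0 \<longrightarrow> finite S)"
  let ?p = "\<lambda>U. \<Sum>S\<in>Pow U. ksign S (U - S) * f S * g (U - S)"
  have "{U. ?p U \<noteq> 0} \<subseteq> (\<lambda>(S, T). S \<union> T) ` ({S. f S \<noteq> 0} \<times> {S. g S \<noteq> 0})"
  proof
    fix U assume "U \<in> {U. ?p U \<noteq> 0}"
    then have "?p U \<noteq> 0" by blast
    then obtain S where S: "S \<in> Pow U" "ksign S (U - S) * f S * g (U - S) \<noteq> 0"
      by (rule sum.not_neutral_contains_not_neutral)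
    then have "(S, U - S) \<in> {S. f S \<noteq> 0} \<times> {S. g S \<noteq> 0}" by auto
    moreover have "(\<lambda>(S, T). S \<union> T) (S, U - S) = U" using S(1) by auto
    ultimately show "U \<in> (\<lambda>(S, T). S \<union> T) ` ({S. f S \<noteq> 0} \<times> {S. g S \<noteq> 0})"
      by (rule image_eqI[rotated, OF _ sym])
  qed
  moreover have "finite ((\<lambda>(S, T). S \<union> T) ` ({S. f S \<noteq> 0} \<times> {S. g S \<noteq> 0}))"
    using f g by simp
  ultimately have "finite {U. ?p U \<noteq> 0}" by (rule finite_subset)
  moreover have "finite U" if "?p U \<noteq> 0" for U
    using that by (cases "finite U") (simp_all add: finite_Pow_iff)
  ultimately show "finite {U. ?p U \<noteq> 0} \<and> (\<forall>U. ?p U \<noteq> 0 \<longrightarrow> finite U)" by blast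
qed

instance
proof
  fix f g h :: "'a grassmann"
  show "f + g + h = f + (g + h)" "f + g = g + f" "0 + f = f" "- f + f = 0"
    by (transfer, simp add: algebra_simps)+
  show "f - g = f + - g" by (rule minus_grassmann_def)
  show "(0::'a grassmann) \<noteq> 1" by transfer (metis zero_neq_one)
  show "(f + g) * h = f * h + g * h" "f * (g + h) = f * g + f * h"
    by (transfer, simp add: algebra_simps sum.distrib)+
  show "1 * f = f"
  proof (rule grassmann_eqI)
    fix U :: "nat set" assume "finite U"
    then have "coeff (1 * f) U = (\<Sum>S\<in>Pow U. if S = {} then coeff f U else 0)"
      unfolding times_grassmann.rep_eq one_grassmann.rep_eq by (intro sum.cong) auto
    then show "coeff (1 * f) U = coeff f U" using \<open>finite U\<close> by (simp add: sum.delta)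
  qed
  show "f * 1 = f"
  proof (rule grassmann_eqI)
    fix U :: "nat set" assume "finite U"
    then have "coeff (f * 1) U = (\<Sum>S\<in>Pow U. if S = U then coeff f U else 0)"
      unfolding times_grassmann.rep_eq one_grassmann.rep_eq by (intro sum.cong) auto
    then show "coeff (f * 1) U = coeff f U" using \<open>finite U\<close> by (simp add: sum.delta)
  qed
  show "f * g * h = f * (g * h)"
  proof (rule grassmann_eqI)
    fix U :: "nat set" assume U: "finite U"
    let ?L = "SIGMA S:Pow U. Pow S" and ?R = "SIGMA A:Pow U. Pow (U - A)"
    have "coeff (f * g * h) U = (\<Sum>(S, A)\<in>?L. ksign S (U - S) *
        (ksign A (S - A) * coeff f A * coeff g (S - A)) * coeff h (U - S))"
      unfolding times_grassmann.rep_eq sum_distrib_left sum_distrib_right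
      by (rule sum.Sigma) (use U in \<open>auto intro: finite_subset\<close>)
    also have "\<dots> = (\<Sum>(A, B)\<in>?R. ksign A (U - A) * coeff f A *
        (ksign B (U - A - B) * coeff g B * coeff h (U - A - B)))"
      (is "sum ?l _ = sum ?r _")
    proof (rule sum.reindex_bij_witness[where j = "\<lambda>(S, A). (A, S - A)"
          and i = "\<lambda>(A, B). (A \<union> B, A)"])
      fix p assume "p \<in> ?L"
      then obtain S A where p: "p = (S, A)" and SA: "S \<subseteq> U" "A \<subseteq> S" by auto
      define B C where "B = S - A" and "C = U - S"
      have fin: "finite A" "finite B" "finite C"
        using SA U by (auto simp: B_def C_def intro: finite_subset)
      have dis: "A \<inter> B = {}" "A \<inter> C = {}" "B \<inter> C = {}"
        using SA by (auto simp: B_def C_def)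
      have eq: "S = A \<union> B" "U - S = C" "U - A = B \<union> C" "U - A - B = C" "S - A = B"
        using SA by (auto simp: B_def C_def)
      have k: "ksign (A \<union> B) C * ksign A B = ksign A (B \<union> C) * (ksign B C :: 'a)"
        using fin dis by (simp add: ksign_Un_left ksign_Un_right)
      have "?r (A, B) = ksign A (B \<union> C) * ksign B C * (coeff f A * coeff g B * coeff h C)"
        unfolding prod.case eq(4) unfolding eq(3) by (simp only: ac_simps)
      also have "\<dots> = ?l (S, A)"
        unfolding prod.case eq(5) unfolding eq(2) unfolding eq(1) k[symmetric]
        by (simp only: ac_simps)
      finally show "?r ((\<lambda>(S, A). (A, S - A)) p) = ?l p"
        unfolding p prod.case eq(5) .
    qed auto
    also have "\<dots> = coeff (f * (g * h)) U"
      unfolding times_grassmann.rep_eq sum_distrib_left sum_distrib_right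
      by (rule sum.Sigma[symmetric]) (use U in \<open>auto intro: finite_subset\<close>)
    finally show "coeff (f * g * h) U = coeff (f * (g * h)) U" .
  qed
qed

end

lift_definition gscale :: "'a::field \<Rightarrow> 'a grassmann \<Rightarrow> 'a grassmann"
  is "\<lambda>c f S. c * f S"
proof -
  fix c :: 'a and f :: "nat set \<Rightarrow> 'a"
  assume *: "finite {S. f S \<noteq> 0} \<and> (\<forall>S. f S \<noteq> 0 \<longrightarrow> finite S)"
  have "{S. c * f S \<noteq> 0} \<subseteq> {S. f S \<noteq> 0}" by auto
  then have "finite {S. c * f S \<noteq> 0}" using * by (blast intro: finite_subset)
  moreover have "finite S" if "c * f S \<noteq> 0" for S
    using that * by (cases "f S = 0") auto
  ultimately show "finite {S. c * f S \<noteq> 0} \<and> (\<forall>S. c * f S \<noteq> 0 \<longrightarrow> finite S)"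
    by blast
qed

lemma coeff_simps [simp]:
  "coeff 0 S = 0" "coeff (f + g) S = coeff f S + coeff g S" "coeff (- f) S = - coeff f S"
  "coeff (f - g) S = coeff f S - coeff g S" "coeff (gscale c f) S = c * coeff f S"
  unfolding minus_grassmann_def
  by (simp_all add: zero_grassmann.rep_eq plus_grassmann.rep_eq
      uminus_grassmann.rep_eq gscale.rep_eq del: add_uminus_conv_diff)

global_interpretation gr: vector_space gscale
  by unfold_locales (rule grassmann_eqI, simp add: algebra_simps)+

lemma gscale_mult [simp]:
  "gscale c f * g = gscale c (f * g)" "f * gscale c g = gscale c (f * g)"
  by (transfer, simp add: sum_distrib_left algebra_simps)+

lift_definition gen :: "nat \<Rightarrow> 'a::field grassmann" is "\<lambda>i S. if S = {i} then 1 else 0"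
  by auto

lemma coeff_sum [simp]: "coeff (sum h A) S = (\<Sum>k\<in>A. coeff (h k) S)"
  by (induction A rule: infinite_finite_induct) auto

lemma coeff_times: "coeff (f * g) U = (\<Sum>S\<in>Pow U. ksign S (U - S) * coeff f S * coeff g (U - S))"
  by (simp add: times_grassmann.rep_eq)

lemma coeff_gen: "coeff (gen i) S = (if S = {i} then 1 else 0)"
  by (simp add: gen.rep_eq)

lemma coeff_gen_mult:
  assumes "finite U"
  shows "coeff (gen i * f) U =
    (if i \<in> U then (- 1) ^ card {s \<in> U. s < i} * coeff f (U - {i}) else (0 :: 'a::field))"
proof -
  have "coeff (gen i * f) U =
      (\<Sum>S\<in>Pow U. if S = {i} then ksign {i} (U - {i}) * coeff f (U - {i}) else 0)"
    unfolding coeff_times coeff_gen by (intro sum.cong) auto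
  also have "\<dots> = (if i \<in> U then ksign {i} (U - {i}) * coeff f (U - {i}) else 0)"
    using assms by (simp add: sum.delta)
  also have "ksign {i} (U - {i}) = ((- 1) ^ card {s \<in> U. s < i} :: 'a)"
  proof -
    have "{(s, t). s \<in> {i} \<and> t \<in> U - {i} \<and> t < s} = Pair i ` {s \<in> U. s < i}" by auto
    then show ?thesis unfolding ksign_def by (simp add: card_image inj_on_def)
  qed
  finally show ?thesis .
qed

lemma gen_square: "gen i * gen i = (0 :: 'a::field grassmann)"
  by (rule grassmann_eqI) (auto simp: coeff_gen_mult coeff_gen)

lemma gen_anticommute: "gen i * gen j = - (gen j * gen i :: 'a::field grassmann)"
proof (cases "i = j")
  case True
  then show ?thesis by (simp add: gen_square)
next
  case False
  have *: "coeff (gen k * gen l) S =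
      (if S = {k, l} then if l < k then - 1 else 1 else (0 :: 'a))"
    if S: "finite S" and "k \<noteq> l" for k l S
  proof (cases "S = {k, l}")
    case True
    have "{s \<in> {k, l}. s < k} = (if l < k then {l} else {})" by auto
    moreover have "{k, l} - {k} = {l}" using \<open>k \<noteq> l\<close> by auto
    ultimately show ?thesis unfolding True by (simp add: coeff_gen_mult coeff_gen)
  next
    case False
    then have "\<not> (k \<in> S \<and> S - {k} = {l})" by auto
    then show ?thesis using S False by (auto simp: coeff_gen_mult coeff_gen)
  qed
  show ?thesis
  proof (rule grassmann_eqI)
    fix S :: "nat set" assume "finite S"
    then show "coeff (gen i * gen j) S = coeff (- (gen j * gen i) :: 'a grassmann) S"
      using *[of S i j] *[of S j i] False
      by (cases i j rule: linorder_cases) (simp_all add: insert_commute)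
  qed
qed

text \<open>The \<open>\<int>\<^sub>2\<close>-grading: a degree is a natural number read modulo 2.\<close>

definition gr_comp :: "nat \<Rightarrow> 'a::field grassmann set" where
  "gr_comp d = {f. \<forall>S. coeff f S \<noteq> 0 \<longrightarrow> card S mod 2 = d mod 2}"

lift_definition gr_part :: "nat \<Rightarrow> 'a::field grassmann \<Rightarrow> 'a grassmann"
  is "\<lambda>d f S. if card S mod 2 = d mod 2 then f S else 0"
proof -
  fix d :: nat and f :: "nat set \<Rightarrow> 'a"
  let ?g = "\<lambda>S. if card S mod 2 = d mod 2 then f S else 0"
  assume f: "finite {S. f S \<noteq> 0} \<and> (\<forall>S. f S \<noteq> 0 \<longrightarrow> finite S)"
  have *: "f S \<noteq> 0" if "?g S \<noteq> 0" for S using that by (simp split: if_splits)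
  then have "{S. ?g S \<noteq> 0} \<subseteq> {S. f S \<noteq> 0}" by blast
  then have "finite {S. ?g S \<noteq> 0}" using f by (blast intro: finite_subset)
  then show "finite {S. ?g S \<noteq> 0} \<and> (\<forall>S. ?g S \<noteq> 0 \<longrightarrow> finite S)" using * f by blast
qed

lemma coeff_gr_part [simp]:
  "coeff (gr_part d f) S = (if card S mod 2 = d mod 2 then coeff f S else 0)"
  by (simp add: gr_part.rep_eq)

lemma gr_part_in [simp]: "gr_part d f \<in> gr_comp d"
  by (simp add: gr_comp_def)

lemma gr_part_sum: "gr_part 0 f + gr_part 1 f = f"
  by (rule grassmann_eqI) (auto simp: mod_2_eq_odd)

lemma gr_part_add [simp]: "gr_part d (f + g) = gr_part d f + gr_part d g"
  and gr_part_scale [simp]: "gr_part d (gscale c f) = gscale c (gr_part d f)"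
  and gr_part_0 [simp]: "gr_part d 0 = 0"
  by (rule grassmann_eqI, simp)+

lemma gr_part_homogeneous:
  assumes "f \<in> gr_comp e"
  shows "gr_part d f = (if d mod 2 = e mod 2 then f else 0)"
  using assms by (intro grassmann_eqI) (auto simp: gr_comp_def)

text \<open>
  The odd superderivation \<open>\<partial>\<^sub>i\<close>: moving \<open>x\<^sub>i\<close> to the front of \<open>x\<^sub>S\<close> and deleting it gives
  \<open>\<partial>\<^sub>i x\<^sub>S = (-1)\<^sup>k x\<^sub>S\<^sub>-\<^sub>{\<^sub>i\<^sub>}\<close> for \<open>i \<in> S\<close>, \<open>k\<close> the number of elements of \<open>S\<close> below \<open>i\<close>, and
  \<open>\<partial>\<^sub>i x\<^sub>S = 0\<close> for \<open>i \<notin> S\<close>. The lemmas \<open>odd_superderivation_gderiv\<close> and \<open>gderiv_gen\<close>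
  are its defining properties.
\<close>

lift_definition gderiv :: "nat \<Rightarrow> 'a::field grassmann \<Rightarrow> 'a grassmann"
  is "\<lambda>i f T. if i \<in> T then 0 else (- 1) ^ card {s \<in> T. s < i} * f (insert i T)"
proof -
  fix i and f :: "nat set \<Rightarrow> 'a"
  assume f: "finite {S. f S \<noteq> 0} \<and> (\<forall>S. f S \<noteq> 0 \<longrightarrow> finite S)"
  let ?g = "\<lambda>T. if i \<in> T then 0 else (- 1) ^ card {s \<in> T. s < i} * f (insert i T)"
  have *: "i \<notin> T \<and> f (insert i T) \<noteq> 0" if "?g T \<noteq> 0" for T
    using that by (auto split: if_splits)
  have "{T. ?g T \<noteq> 0} \<subseteq> (\<lambda>S. S - {i}) ` {S. f S \<noteq> 0}"
  proof
    fix T assume "T \<in> {T. ?g T \<noteq> 0}"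
    then have "i \<notin> T" "f (insert i T) \<noteq> 0" using * by blast+
    then show "T \<in> (\<lambda>S. S - {i}) ` {S. f S \<noteq> 0}"
      by (intro image_eqI[where x = "insert i T"]) simp_all
  qed
  then have "finite {T. ?g T \<noteq> 0}" using f by (blast intro: finite_subset)
  moreover have "finite T" if "?g T \<noteq> 0" for T
    using *[OF that] f by (metis finite_insert)
  ultimately show "finite {T. ?g T \<noteq> 0} \<and> (\<forall>T. ?g T \<noteq> 0 \<longrightarrow> finite T)" by blast
qed

lemma coeff_gderiv:
  "coeff (gderiv i f) T =
    (if i \<in> T then 0 else (- 1) ^ card {s \<in> T. s < i} * coeff f (insert i T))"
  by (simp add: gderiv.rep_eq)

lemma gderiv_add [simp]: "gderiv i (f + g) = gderiv i f + gderiv i g"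
  and gderiv_scale [simp]: "gderiv i (gscale c f) = gscale c (gderiv i f)"
  by (rule grassmann_eqI, simp add: coeff_gderiv algebra_simps)+

lemma gderiv_gen: "gderiv i (gen j) = (if i = j then 1 else (0 :: 'a::field grassmann))"
proof (rule grassmann_eqI)
  fix T :: "nat set"
  have "insert i T = {j} \<longleftrightarrow> i = j \<and> T = {}" if "i \<notin> T" using that by auto
  then show "coeff (gderiv i (gen j)) T = coeff (if i = j then 1 else (0 :: 'a grassmann)) T"
    by (auto simp: coeff_gderiv coeff_gen one_grassmann.rep_eq)
qed

definition odd_superderivation :: "('a::field grassmann \<Rightarrow> 'a grassmann) \<Rightarrow> bool" where
  "odd_superderivation D \<longleftrightarrow> Vector_Spaces.linear gscale gscale D \<and>
    (\<forall>d. \<forall>f\<in>gr_comp d. D f \<in> gr_comp (d + 1)) \<and>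
    (\<forall>d. \<forall>f\<in>gr_comp d. \<forall>g. D (f * g) = D f * g + (- 1) ^ d * f * D g)"

lemma glinear_iff:
  "Vector_Spaces.linear gscale gscale F \<longleftrightarrow>
    (\<forall>f g. F (f + g) = F f + F g) \<and> (\<forall>c f. F (gscale c f) = gscale c (F f))"
  by (simp add: Vector_Spaces.linear_iff gr.vector_space_axioms)

lemma coeff_sign_mult: "coeff ((- 1) ^ d * f) T = (- 1) ^ d * coeff f T"
  by (cases "even d") auto

lemma sum_Pow_insert:
  assumes "finite T" "i \<notin> T"
  shows "sum h (Pow (insert i T)) = (\<Sum>S\<in>Pow T. h S + h (insert i S) :: 'a::field)"
proof -
  have "inj_on (insert i) (Pow T)" using assms(2) by (auto simp: inj_on_def)
  moreover have "Pow T \<inter> insert i ` Pow T = {}" using assms(2) by auto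
  ultimately show ?thesis using assms
    by (simp add: Pow_insert sum.union_disjoint sum.reindex sum.distrib)
qed

lemma ksign_insert_left:
  assumes "finite A" "finite B" "i \<notin> A"
  shows "ksign (insert i A) B = ksign A B * ((- 1) ^ card {s \<in> B. s < i} :: 'a::ring_1)"
proof -
  have "{(s, t). s \<in> {i} \<and> t \<in> B \<and> t < s} = Pair i ` {s \<in> B. s < i}" by auto
  then have "ksign {i} B = ((- 1) ^ card {s \<in> B. s < i} :: 'a)"
    unfolding ksign_def by (simp add: card_image inj_on_def)
  then show ?thesis using ksign_Un_left[of A "{i}" B, where 'a = 'a] assms by simp
qed

lemma ksign_insert_right:
  assumes "finite A" "finite B" "i \<notin> A" "i \<notin> B"
  shows "ksign A (insert i B) * (- 1) ^ card {s \<in> A. s < i} =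
    ksign A B * ((- 1) ^ card A :: 'a::ring_1)"
proof -
  have "{(s, t). s \<in> A \<and> t \<in> {i} \<and> t < s} = (\<lambda>s. (s, i)) ` {s \<in> A. i < s}" by auto
  then have "ksign A {i} = ((- 1) ^ card {s \<in> A. i < s} :: 'a)"
    unfolding ksign_def by (simp add: card_image inj_on_def)
  moreover have "card A = card {s \<in> A. i < s} + card {s \<in> A. s < i}"
  proof -
    have "A = {s \<in> A. i < s} \<union> {s \<in> A. s < i}"
      using assms(3) by (auto simp: neq_iff) (metis linorder_less_linear)
    moreover have "card ({s \<in> A. i < s} \<union> {s \<in> A. s < i}) =
        card {s \<in> A. i < s} + card {s \<in> A. s < i}"
      by (rule card_Un_disjoint) (use assms(1) in auto)
    ultimately show ?thesis by argo
  qed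
  ultimately show ?thesis
    using ksign_Un_right[of B "{i}" A, where 'a = 'a] assms by (simp add: power_add mult.assoc)
qed

lemma card_less_Diff:
  assumes "finite T" "S \<subseteq> T"
  shows "card {s \<in> T. s < i} = card {s \<in> S. s < i} + card {s \<in> T - S. s < (i :: nat)}"
proof -
  have "{s \<in> T. s < i} = {s \<in> S. s < i} \<union> {s \<in> T - S. s < i}" using assms by auto
  also have "card \<dots> = card {s \<in> S. s < i} + card {s \<in> T - S. s < i}"
    by (rule card_Un_disjoint) (use assms finite_subset in auto)
  finally show ?thesis .
qed

lemma sign_sq: "(- 1) ^ n * (- 1) ^ n = (1 :: 'a::ring_1)"
  by (simp flip: power_add)

lemma gderiv_mult:
  fixes f g :: "'a::field grassmann"
  assumes f: "f \<in> gr_comp d"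
  shows "gderiv i (f * g) = gderiv i f * g + (- 1) ^ d * f * gderiv i g"
proof (rule grassmann_eqI)
  fix T :: "nat set" assume T: "finite T"
  define s :: "nat set \<Rightarrow> 'a" where "s = (\<lambda>A. (- 1) ^ card {t \<in> A. t < i})"
  have ss: "s A * s A = 1" for A by (simp add: s_def sign_sq)
  have fd: "(- 1) ^ card S * coeff f S = (- 1) ^ d * coeff f S" for S
  proof (cases "coeff f S = 0")
    case False
    then have "card S mod 2 = d mod 2" using f by (simp add: gr_comp_def)
    then have "even (card S) \<longleftrightarrow> even d" by presburger
    then show ?thesis by (simp add: minus_one_power_iff)
  qed simp
  have dF: "coeff (gderiv i h) A = (if i \<in> A then 0 else s A * coeff h (insert i A))"
    for h :: "'a grassmann" and A
    by (simp add: coeff_gderiv s_def)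
  have R: "coeff (gderiv i f * g + (- 1) ^ d * f * gderiv i g) T =
      (\<Sum>S\<in>Pow T. ksign S (T - S) * (coeff (gderiv i f) S * coeff g (T - S) +
        (- 1) ^ d * coeff f S * coeff (gderiv i g) (T - S)))"
    unfolding coeff_simps coeff_times[of "gderiv i f"] coeff_times[of _ "gderiv i g"]
      coeff_sign_mult sum.distrib[symmetric]
    by (simp add: algebra_simps)
  show "coeff (gderiv i (f * g)) T = coeff (gderiv i f * g + (- 1) ^ d * f * gderiv i g) T"
  proof (cases "i \<in> T")
    case True
    define W where "W = T - {i}"
    have W: "T = insert i W" "i \<notin> W" "finite W" using True T by (auto simp: W_def)
    have "ksign A (T - A) * (coeff (gderiv i f) A * coeff g (T - A) +
        (- 1) ^ d * coeff f A * coeff (gderiv i g) (T - A)) +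
      ksign (insert i A) (T - insert i A) *
        (coeff (gderiv i f) (insert i A) * coeff g (T - insert i A) +
        (- 1) ^ d * coeff f (insert i A) * coeff (gderiv i g) (T - insert i A)) = 0"
      if A: "A \<in> Pow W" for A
    proof -
      define B where "B = W - A"
      have fin: "finite A" "finite B" "i \<notin> A" "i \<notin> B"
        using A W by (auto simp: B_def intro: finite_subset)
      have e: "T - A = insert i B" "T - insert i A = B" using W A by (auto simp: B_def)
      have 1: "ksign A (insert i B) * s A * coeff f (insert i A) =
          - (ksign A B * (- 1) ^ d * coeff f (insert i A))"
        using fd[of "insert i A", symmetric] fin ksign_insert_right[of A B i, where 'a = 'a]
        by (simp add: s_def mult.assoc)
      have 2: "ksign (insert i A) B * s B = ksign A B"
        using ksign_insert_left[of A B i, where 'a = 'a] fin ss[of B]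
        by (simp add: s_def mult.assoc)
      have "ksign A (insert i B) * (s A * coeff f (insert i A) * coeff g (insert i B)) +
          ksign (insert i A) B * ((- 1) ^ d * coeff f (insert i A) * (s B * coeff g (insert i B))) =
          (ksign A (insert i B) * s A * coeff f (insert i A)) * coeff g (insert i B) +
          (ksign (insert i A) B * s B) * (- 1) ^ d * coeff f (insert i A) * coeff g (insert i B)"
        by (simp only: ac_simps)
      also have "\<dots> = 0" unfolding 1 2 by simp
      finally show ?thesis unfolding e dF using fin by simp
    qed
    then have "coeff (gderiv i f * g + (- 1) ^ d * f * gderiv i g) T = 0"
      unfolding R unfolding W(1) sum_Pow_insert[OF W(3,2)] by (intro sum.neutral) blast
    then show ?thesis using True by (simp add: dF)
  next
    case False
    have "s T * (ksign A (insert i T - A) * coeff f A * coeff g (insert i T - A) +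
        ksign (insert i A) (insert i T - insert i A) * coeff f (insert i A) *
          coeff g (insert i T - insert i A)) =
      ksign A (T - A) * (coeff (gderiv i f) A * coeff g (T - A) +
        (- 1) ^ d * coeff f A * coeff (gderiv i g) (T - A))"
      if A: "A \<in> Pow T" for A
    proof -
      define B where "B = T - A"
      have fin: "finite A" "finite B" "i \<notin> A" "i \<notin> B"
        using A T False by (auto simp: B_def intro: finite_subset)
      have e: "insert i T - A = insert i B" "insert i T - insert i A = B" "T - A = B"
        using A False by (auto simp: B_def)
      have sT: "s T = s A * s B"
        using card_less_Diff[OF T, of A i] A by (simp add: s_def B_def power_add)
      have 1: "ksign A (insert i B) * s A * coeff f A = ksign A B * (- 1) ^ d * coeff f A"
        using fd[of A] fin ksign_insert_right[of A B i, where 'a = 'a]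
        by (simp add: s_def mult.assoc)
      have 2: "s B * ksign (insert i A) B = ksign A B"
        using ksign_insert_left[of A B i, where 'a = 'a] fin ss[of B]
        by (simp add: s_def ac_simps)
      have "s T * (ksign A (insert i B) * coeff f A * coeff g (insert i B) +
          ksign (insert i A) B * coeff f (insert i A) * coeff g B) =
        (ksign A (insert i B) * s A * coeff f A) * s B * coeff g (insert i B) +
          (s B * ksign (insert i A) B) * s A * coeff f (insert i A) * coeff g B"
        unfolding sT distrib_left by (simp only: ac_simps)
      also have "\<dots> = ksign A B * (s A * coeff f (insert i A) * coeff g B +
          (- 1) ^ d * coeff f A * (s B * coeff g (insert i B)))"
        unfolding 1 2 distrib_left by (simp only: ac_simps)
      finally show ?thesis unfolding e dF using fin by simp
    qed
    then show ?thesis using False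
      unfolding R by (simp add: dF coeff_times sum_Pow_insert[OF T False] sum_distrib_left)
  qed
qed

lemma gderiv_parity: "f \<in> gr_comp d \<Longrightarrow> gderiv i f \<in> gr_comp (d + 1)"
proof -
  assume f: "f \<in> gr_comp d"
  have "card T mod 2 = (d + 1) mod 2" if "coeff (gderiv i f) T \<noteq> 0" for T
  proof -
    have T: "i \<notin> T" "coeff f (insert i T) \<noteq> 0" using that by (auto simp: coeff_gderiv split: if_splits)
    then have "finite T" using coeff_infinite[of "insert i T" f] by (cases "finite T") simp_all
    moreover have "card (insert i T) mod 2 = d mod 2" using f T(2) unfolding gr_comp_def by blast
    ultimately show ?thesis using T(1) by (simp add: mod_Suc split: if_splits)
  qed
  then show ?thesis by (simp add: gr_comp_def)
qed

lemma odd_superderivation_gderiv: "odd_superderivation (gderiv i)"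
  unfolding odd_superderivation_def glinear_iff
  using gderiv_mult gderiv_parity by auto

section \<open>The superalgebra of linear endomorphisms\<close>

typedef (overloaded) 'a endo =
  "{F :: 'a::field grassmann \<Rightarrow> 'a grassmann. Vector_Spaces.linear gscale gscale F}"
  morphisms app Abs_endo
  by (rule exI[of _ "\<lambda>_. 0"]) (simp add: glinear_iff)

setup_lifting type_definition_endo

lemma app_add [simp]: "app a (f + g) = app a f + app a g"
  and app_scale [simp]: "app a (gscale c f) = gscale c (app a f)"
  using app[of a] by (auto simp: glinear_iff)

lemma app_0 [simp]: "app a 0 = 0"
  using app_add[of a 0 0] by simp

lemma endo_eqI: "(\<And>f. app a f = app b f) \<Longrightarrow> a = b"
  by (simp add: app_inject[symmetric] fun_eq_iff)

instantiation endo :: (field) ring_1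
begin

lift_definition zero_endo :: "'a endo" is "\<lambda>_. 0" by (simp add: glinear_iff)
lift_definition one_endo :: "'a endo" is "\<lambda>f. f" by (simp add: glinear_iff)
lift_definition plus_endo :: "'a endo \<Rightarrow> 'a endo \<Rightarrow> 'a endo" is "\<lambda>a b f. a f + b f"
  by (simp add: glinear_iff algebra_simps gr.scale_right_distrib)
lift_definition uminus_endo :: "'a endo \<Rightarrow> 'a endo" is "\<lambda>a f. - a f"
  by (simp add: glinear_iff)
lift_definition minus_endo :: "'a endo \<Rightarrow> 'a endo \<Rightarrow> 'a endo" is "\<lambda>a b f. a f - b f"
  by (simp add: glinear_iff algebra_simps gr.scale_right_diff_distrib)
lift_definition times_endo :: "'a endo \<Rightarrow> 'a endo \<Rightarrow> 'a endo" is "\<lambda>a b f. a (b f)"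
  by (simp add: glinear_iff)

instance
proof
  fix a b c :: "'a endo"
  show "a + b + c = a + (b + c)" "a + b = b + a" "0 + a = a" "- a + a = 0" "a - b = a + - b"
    "a * b * c = a * (b * c)" "1 * a = a" "a * 1 = a" "(a + b) * c = a * c + b * c"
    "a * (b + c) = a * b + a * c"
    by (rule endo_eqI, simp add: plus_endo.rep_eq zero_endo.rep_eq uminus_endo.rep_eq
        minus_endo.rep_eq times_endo.rep_eq one_endo.rep_eq algebra_simps)+
  have "app (0 :: 'a endo) 1 \<noteq> app 1 1" by (simp add: zero_endo.rep_eq one_endo.rep_eq)
  then show "(0 :: 'a endo) \<noteq> 1" by metis
qed

end

lift_definition escale :: "'a::field \<Rightarrow> 'a endo \<Rightarrow> 'a endo" is "\<lambda>c a f. gscale c (a f)"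
  by (simp add: glinear_iff gr.scale_right_distrib gr.scale_left_commute)

lemma app_simps [simp]:
  "app 0 f = 0" "app 1 f = f" "app (a + b) f = app a f + app b f" "app (- a) f = - app a f"
  "app (a - b) f = app a f - app b f" "app (a * b) f = app a (app b f)"
  "app (escale c a) f = gscale c (app a f)"
  by (simp_all add: plus_endo.rep_eq zero_endo.rep_eq uminus_endo.rep_eq
      minus_endo.rep_eq times_endo.rep_eq one_endo.rep_eq escale.rep_eq)

global_interpretation en: vector_space escale
  by unfold_locales (rule endo_eqI, simp add: gr.scale_right_distrib gr.scale_left_distrib)+

definition endo_comp :: "nat \<Rightarrow> 'a::field endo set" where
  "endo_comp d = {a. \<forall>e. \<forall>f\<in>gr_comp e. app a f \<in> gr_comp (d + e)}"

text \<open>The projections of \<open>End \<Lambda>\<close> onto its homogeneous components, valid in every characteristic.\<close>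

lift_definition endo_part :: "nat \<Rightarrow> 'a::field endo \<Rightarrow> 'a endo"
  is "\<lambda>d a f. gr_part d (a (gr_part 0 f)) + gr_part (d + 1) (a (gr_part 1 f))"
  by (simp add: glinear_iff gr.scale_right_distrib)

lemma endo_part_sum: "endo_part 0 a + endo_part 1 a = a"
proof (rule endo_eqI)
  fix f
  have 2: "gr_part 2 g = gr_part 0 g" for g :: "'a grassmann"
    by (rule grassmann_eqI) simp
  have "app (endo_part 0 a + endo_part 1 a) f =
    (gr_part 0 (app a (gr_part 0 f)) + gr_part 1 (app a (gr_part 0 f))) +
    (gr_part 0 (app a (gr_part 1 f)) + gr_part 1 (app a (gr_part 1 f)))"
    by (simp add: endo_part.rep_eq 2 numeral_2_eq_2[symmetric])
  also have "\<dots> = app a (gr_part 0 f + gr_part 1 f)"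
    unfolding gr_part_sum app_add[symmetric] ..
  finally show "app (endo_part 0 a + endo_part 1 a) f = app a f" unfolding gr_part_sum .
qed

lemma gr_comp_cong: "d mod 2 = e mod 2 \<Longrightarrow> gr_comp d = gr_comp e"
  by (simp add: gr_comp_def)

lemma gr_comp_add: "f \<in> gr_comp d \<Longrightarrow> g \<in> gr_comp d \<Longrightarrow> f + g \<in> gr_comp d"
  unfolding gr_comp_def by simp (metis add_0)

lemma gr_comp_0: "0 \<in> gr_comp d"
  by (simp add: gr_comp_def)

lemma endo_part_in: "endo_part d a \<in> endo_comp d"
  unfolding endo_comp_def
proof (clarify)
  fix e :: nat and f :: "'a grassmann" assume f: "f \<in> gr_comp e"
  show "app (endo_part d a) f \<in> gr_comp (d + e)"
  proof (cases "even e")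
    case True
    then have "gr_part 0 f = f" "gr_part 1 f = 0" "gr_comp (d + e) = (gr_comp d :: 'a grassmann set)"
      using f by (simp_all add: gr_part_homogeneous mod_2_eq_odd, intro gr_comp_cong, presburger)
    then show ?thesis by (simp add: endo_part.rep_eq)
  next
    case False
    then have "gr_part 0 f = 0" "gr_part 1 f = f"
      "gr_comp (d + e) = (gr_comp (d + 1) :: 'a grassmann set)"
      using f by (simp_all add: gr_part_homogeneous mod_2_eq_odd, intro gr_comp_cong, presburger)
    then show ?thesis by (simp add: endo_part.rep_eq del: One_nat_def)
  qed
qed

lemma endo_part_homogeneous:
  assumes a: "a \<in> endo_comp e"
  shows "endo_part d a = (if d mod 2 = e mod 2 then a else 0)"
proof (rule endo_eqI)
  fix f :: "'a grassmann"
  have "app a (gr_part 0 f) \<in> gr_comp (e + 0)" "app a (gr_part 1 f) \<in> gr_comp (e + 1)"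
    using a gr_part_in unfolding endo_comp_def by blast+
  note h = this[THEN gr_part_homogeneous]
  have "app (endo_part d a) f =
      (if d mod 2 = e mod 2 then app a (gr_part 0 f + gr_part 1 f) else 0)"
    unfolding endo_part.rep_eq h app_add by (auto simp: mod_2_eq_odd)
  then show "app (endo_part d a) f = app (if d mod 2 = e mod 2 then a else 0) f"
    unfolding gr_part_sum by simp
qed

text \<open>
  The bilinear extension of \<open>[a, b] = a b - (-1)\<^sup>d\<^sup>e b a\<close> for homogeneous \<open>a\<close>, \<open>b\<close> of degrees
  \<open>d\<close>, \<open>e\<close>; see \<open>scomm_homogeneous\<close>.
\<close>

definition scomm :: "'a::field endo \<Rightarrow> 'a endo \<Rightarrow> 'a endo" where
  "scomm a b = (\<Sum>d\<in>{0, 1}. \<Sum>e\<in>{0, 1}.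
     endo_part d a * endo_part e b - (- 1) ^ (d * e) * endo_part e b * endo_part d a)"

lemma scomm_homogeneous:
  assumes "a \<in> endo_comp d" "b \<in> endo_comp e"
  shows "scomm a b = a * b - (- 1) ^ (d * e) * b * a"
  unfolding scomm_def
  by (cases "even d"; cases "even e")
    (simp_all add: endo_part_homogeneous[OF assms(1)] endo_part_homogeneous[OF assms(2)]
      mod_2_eq_odd)

section \<open>The pivot elements and the Lie superalgebra they generate\<close>

definition lmult :: "'a::field grassmann \<Rightarrow> 'a endo" where
  "lmult f = Abs_endo (\<lambda>g. f * g)"

lemma app_lmult [simp]: "app (lmult f) g = f * g"
  unfolding lmult_def
  by (subst Abs_endo_inverse) (simp_all add: glinear_iff algebra_simps)

lift_definition deriv_endo :: "nat \<Rightarrow> 'a::field endo" is gderiv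
  by (simp add: glinear_iff)

lemma gderiv_eventually_0: "\<exists>N. \<forall>j\<ge>N. gderiv j f = 0"
proof -
  have "finite (\<Union>{S. coeff f S \<noteq> 0})"
  proof (rule finite_Union[OF finite_coeff])
    fix S assume "S \<in> {S. coeff f S \<noteq> 0}"
    then show "finite S" using coeff_infinite[of S f] by (cases "finite S") simp_all
  qed
  then obtain N where N: "\<forall>j\<in>\<Union>{S. coeff f S \<noteq> 0}. j < N"
    unfolding finite_nat_set_iff_bounded ..
  have "gderiv j f = 0" if j: "j \<ge> N" for j
  proof (rule grassmann_eqI)
    fix T :: "nat set"
    have "coeff f (insert j T) = 0"
    proof (rule ccontr)
      assume "coeff f (insert j T) \<noteq> 0"
      then have "j \<in> \<Union>{S. coeff f S \<noteq> 0}" by (intro UnionI[where X = "insert j T"]) simp_all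
      with N have "j < N" by (rule bspec)
      with j show False by simp
    qed
    then show "coeff (gderiv j f) T = coeff 0 T" by (simp add: coeff_gderiv)
  qed
  then show ?thesis by blast
qed

text \<open>
  Unfolding \<open>v\<^sub>i = \<partial>\<^sub>i + x\<^sub>i x\<^sub>i\<^sub>+\<^sub>1 v\<^sub>i\<^sub>+\<^sub>2\<close> gives the sum over \<open>k\<close> of
  \<open>x\<^sub>i x\<^sub>i\<^sub>+\<^sub>1 \<cdots> x\<^sub>i\<^sub>+\<^sub>2\<^sub>k\<^sub>-\<^sub>1 \<partial>\<^sub>i\<^sub>+\<^sub>2\<^sub>k\<close>. On a fixed element only finitely many terms are nonzero.
  The recursion is proved as \<open>pivot_rec\<close>.
\<close>

definition pivot_fun :: "nat \<Rightarrow> 'a::field grassmann \<Rightarrow> 'a grassmann" where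
  "pivot_fun i f = (\<Sum>k | gderiv (i + 2 * k) f \<noteq> 0.
     prod_list (map gen [i..<i + 2 * k]) * gderiv (i + 2 * k) f)"

lemma pivot_fun_eq:
  assumes "\<forall>j\<ge>N. gderiv j f = 0"
  shows "pivot_fun i f = (\<Sum>k<N. prod_list (map gen [i..<i + 2 * k]) * gderiv (i + 2 * k) f)"
  unfolding pivot_fun_def
proof (rule sum.mono_neutral_left)
  show "{k. gderiv (i + 2 * k) f \<noteq> 0} \<subseteq> {..<N}"
  proof clarify
    fix k assume "gderiv (i + 2 * k) f \<noteq> 0"
    then have "i + 2 * k < N" using assms not_less by blast
    then show "k < N" by simp
  qed
qed auto

lift_definition pivot :: "nat \<Rightarrow> 'a::field endo" is pivot_fun
proof -
  fix i
  show "Vector_Spaces.linear gscale gscale (pivot_fun i :: 'a grassmann \<Rightarrow> _)"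
    unfolding glinear_iff
  proof (intro conjI allI)
    fix f g :: "'a grassmann" and c :: 'a
    obtain M N where M: "\<forall>j\<ge>M. gderiv j f = 0" and N: "\<forall>j\<ge>N. gderiv j g = 0"
      using gderiv_eventually_0 by blast
    have m: "\<forall>j\<ge>max M N. gderiv j f = 0" "\<forall>j\<ge>max M N. gderiv j g = 0"
      "\<forall>j\<ge>max M N. gderiv j (f + g) = 0"
      using M N by simp_all
    show "pivot_fun i (f + g) = pivot_fun i f + pivot_fun i g"
      unfolding m[THEN pivot_fun_eq] by (simp add: sum.distrib algebra_simps)
    have c: "\<forall>j\<ge>M. gderiv j (gscale c f) = 0" using M by simp
    show "pivot_fun i (gscale c f) = gscale c (pivot_fun i f)"
      unfolding pivot_fun_eq[OF M] pivot_fun_eq[OF c] by (simp add: gr.scale_sum_right)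
  qed
qed

lemma pivot_rec:
  "pivot i = deriv_endo i + lmult (gen i * gen (i + 1)) * pivot (i + 2)"
proof (rule endo_eqI)
  fix f :: "'a grassmann"
  obtain N where N: "\<forall>j\<ge>N. gderiv j f = 0" using gderiv_eventually_0 by blast
  then have N': "\<forall>j\<ge>Suc N. gderiv j f = 0" by simp
  have u: "[i..<i + 2 * Suc k] = i # (i + 1) # [i + 2..<i + 2 + 2 * k]" for k
    by (simp add: upt_rec[of i] upt_rec[of "Suc i"])
  have a: "i + 2 * Suc k = i + 2 + 2 * k" for k by simp
  have "pivot_fun i f = gderiv i f + (\<Sum>k<N. gen i * (gen (i + 1) *
      (prod_list (map gen [i + 2..<i + 2 + 2 * k]) * gderiv (i + 2 + 2 * k) f)))"
    unfolding pivot_fun_eq[OF N'] sum.lessThan_Suc_shift u unfolding a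
    by (simp only: list.map prod_list.Cons mult.assoc) simp
  also have "\<dots> = gderiv i f + gen i * gen (i + 1) * pivot_fun (i + 2) f"
    unfolding pivot_fun_eq[OF N] by (simp only: sum_distrib_left mult.assoc)
  finally have "pivot_fun i f = gderiv i f + gen i * gen (i + 1) * pivot_fun (i + 2) f" .
  then show "app (pivot i) f =
      app (deriv_endo i + lmult (gen i * gen (i + 1)) * pivot (i + 2)) f"
    by (simp add: pivot.rep_eq deriv_endo.rep_eq)
qed

definition graded_subspace :: "'a::field endo set \<Rightarrow> bool" where
  "graded_subspace W \<longleftrightarrow> en.subspace W \<and>
    (\<forall>a\<in>W. \<exists>b\<in>W \<inter> endo_comp 0. \<exists>c\<in>W \<inter> endo_comp 1. a = b + c)"

definition lie_subsuperalgebra :: "'a::field endo set \<Rightarrow> bool" where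
  "lie_subsuperalgebra W \<longleftrightarrow> graded_subspace W \<and>
    (\<forall>a\<in>W. \<forall>b\<in>W. scomm a b \<in> W) \<and>
    (CHAR('a) = 2 \<longrightarrow> (\<forall>a\<in>W \<inter> endo_comp 1. a * a \<in> W))"

definition Lie :: "'a::field endo set \<Rightarrow> 'a endo set" where
  "Lie X = \<Inter>{W. lie_subsuperalgebra W \<and> X \<subseteq> W}"

definition RR :: "'a::field endo set" where
  "RR = Lie {pivot 0, pivot 1}"

lemma endo_part_add: "endo_part d (a + b) = endo_part d a + endo_part d b"
  by (rule endo_eqI) (simp add: endo_part.rep_eq)

lemma graded_subspace_iff:
  "graded_subspace W \<longleftrightarrow> en.subspace W \<and> (\<forall>a\<in>W. endo_part 0 a \<in> W \<and> endo_part 1 a \<in> W)"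
proof
  assume W: "graded_subspace W"
  have "endo_part 0 a \<in> W \<and> endo_part 1 a \<in> W" if "a \<in> W" for a
  proof -
    from W that have "\<exists>b\<in>W \<inter> endo_comp 0. \<exists>c\<in>W \<inter> endo_comp 1. a = b + c"
      unfolding graded_subspace_def by (elim conjE bspec)
    then obtain b c where bc: "b \<in> W" "b \<in> endo_comp 0" "c \<in> W" "c \<in> endo_comp 1" "a = b + c"
      by blast
    have "endo_part 0 a = b" "endo_part 1 a = c"
      unfolding bc(5) endo_part_add
      by (simp_all add: endo_part_homogeneous[OF bc(2)] endo_part_homogeneous[OF bc(4)])
    then show ?thesis using bc by simp
  qed
  then show "en.subspace W \<and> (\<forall>a\<in>W. endo_part 0 a \<in> W \<and> endo_part 1 a \<in> W)"
    using W by (simp add: graded_subspace_def)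
next
  assume W: "en.subspace W \<and> (\<forall>a\<in>W. endo_part 0 a \<in> W \<and> endo_part 1 a \<in> W)"
  have "\<exists>b\<in>W \<inter> endo_comp 0. \<exists>c\<in>W \<inter> endo_comp 1. a = b + c" if "a \<in> W" for a
    using W that by (intro bexI[where x = "endo_part 0 a"] bexI[where x = "endo_part 1 a"])
      (simp_all only: endo_part_sum endo_part_in Int_iff simp_thms)
  then show "graded_subspace W" using W unfolding graded_subspace_def by blast
qed

lemma lie_subsuperalgebra_Lie: "lie_subsuperalgebra (Lie X)"
  unfolding lie_subsuperalgebra_def graded_subspace_iff Lie_def
  by (auto simp: en.subspace_def)

lemma Lie_superset: "X \<subseteq> Lie X"
  and Lie_least: "lie_subsuperalgebra W \<Longrightarrow> X \<subseteq> W \<Longrightarrow> Lie X \<subseteq> W"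
  by (auto simp: Lie_def)

end

theory Submission
  imports Defs
begin

text \<open>
  Weight the generator \<open>x\<^sub>i\<close> by \<open>N - i\<close> for \<open>i < N\<close> and by \<open>0\<close> otherwise. An even
  superderivation \<open>a\<close> that is triangular, \<open>a x\<^sub>k \<in> \<Lambda>(x\<^sub>0, \<dots>, x\<^sub>k\<^sub>-\<^sub>1)\<close>, and maps every
  \<open>x\<^sub>k\<close> with \<open>k \<ge> N\<close> into the ideal generated by \<open>x\<^sub>0, \<dots>, x\<^sub>N\<^sub>-\<^sub>1\<close> strictly raises the
  weight, because \<open>a x\<^sub>k\<close> is odd and so has no constant term. Weights are bounded, so \<open>a\<close> is
  nilpotent as an operator, and with it \<open>ad a\<close>. The requirement that, for each \<open>m\<close> and all
  large \<open>N\<close>, the \<open>x\<^sub>k\<close> with \<open>k \<ge> N\<close> are mapped into the \<open>m\<close>-th power of that ideal is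
  stable under brackets, since a superderivation lowers the power by at most one, and it holds
  for the pivots. So it holds throughout \<open>R\<close>. If \<open>a\<close> is odd, then \<open>(ad a)\<^sup>2 = ad (a\<^sup>2)\<close> with
  \<open>a\<^sup>2\<close> even.
\<close>

section \<open>Monomials and weight filtrations\<close>

lift_definition gmon :: "nat set \<Rightarrow> 'a::field grassmann"
  is "\<lambda>S T. if finite S \<and> T = S then 1 else 0"
  by auto

lemma coeff_gmon: "coeff (gmon S) T = (if finite S \<and> T = S then 1 else 0)"
  by (simp add: gmon.rep_eq)

lemma gmon_empty: "gmon {} = 1"
  by (rule grassmann_eqI) (simp add: coeff_gmon one_grassmann.rep_eq)

text \<open>Sorting \<open>gen i\<close> into the word for \<open>S\<close> passes exactly the
  smaller letters, and this sign is its own inverse. It reduces claims about monomials to induction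
  on finite sets.\<close>

lemma gmon_insert:
  assumes "finite S" "i \<notin> S"
  shows "gmon (insert i S) =
    gscale ((- 1) ^ card {s \<in> S. s < i}) (gen i * gmon S :: 'a::field grassmann)"
proof (rule grassmann_eqI)
  fix U :: "nat set" assume U: "finite U"
  show "coeff (gmon (insert i S)) U =
      coeff (gscale ((- 1) ^ card {s \<in> S. s < i}) (gen i * gmon S :: 'a grassmann)) U"
  proof (cases "U = insert i S")
    case True
    have "{s \<in> insert i S. s < i} = {s \<in> S. s < i}" by auto
    then show ?thesis
      unfolding coeff_simps coeff_gen_mult[OF U] unfolding True coeff_gmon
      using assms by (simp add: sign_sq)
  next
    case False
    then have "\<not> (i \<in> U \<and> U - {i} = S)" by auto
    then show ?thesis
      unfolding coeff_simps coeff_gen_mult[OF U] unfolding coeff_gmon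
      using assms False by simp
  qed
qed

lemma grassmann_expansion: "f = (\<Sum>S | coeff f S \<noteq> 0. gscale (coeff f S) (gmon S))"
proof (rule grassmann_eqI)
  fix T :: "nat set" assume T: "finite T"
  have "coeff (\<Sum>S | coeff f S \<noteq> 0. gscale (coeff f S) (gmon S)) T =
      (\<Sum>S | coeff f S \<noteq> 0. if S = T then coeff f T else 0)"
    using T by (auto simp: coeff_gmon intro!: sum.cong)
  then show "coeff f T = coeff (\<Sum>S | coeff f S \<noteq> 0. gscale (coeff f S) (gmon S)) T"
    using finite_coeff[of f] by (simp add: sum.delta)
qed

text \<open>Controls the support of a product: weight, parity and occurring generators can all be
  read off from a disjoint union, so signs and cancellation never enter.\<close>

lemma coeff_times_nonzeroE:
  assumes "coeff (f * g) U \<noteq> 0"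
  obtains S T where "U = S \<union> T" "S \<inter> T = {}" "finite S" "finite T" "coeff f S \<noteq> 0" "coeff g T \<noteq> 0"
proof -
  from assms have "(\<Sum>S\<in>Pow U. ksign S (U - S) * coeff f S * coeff g (U - S)) \<noteq> 0"
    by (simp add: coeff_times)
  then obtain S where S: "S \<in> Pow U" "ksign S (U - S) * coeff f S * coeff g (U - S) \<noteq> 0"
    by (rule sum.not_neutral_contains_not_neutral)
  then have "coeff f S \<noteq> 0" "coeff g (U - S) \<noteq> 0" by auto
  then show thesis
    using S(1) coeff_infinite[of S f] coeff_infinite[of "U - S" g]
    by (intro that[of S "U - S"]) auto
qed

section \<open>Filtrations of the Grassmann algebra by weight\<close>

text \<open>Weights are integers so that operators shifting the weight by a negative amount are
  covered too.\<close>

definition weight_filt :: "(nat \<Rightarrow> int) \<Rightarrow> int \<Rightarrow> 'a::field grassmann set" where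
  "weight_filt w k = {f. \<forall>S. coeff f S \<noteq> 0 \<longrightarrow> k \<le> sum w S}"

lemma weight_filt_0: "0 \<in> weight_filt w k"
  by (simp add: weight_filt_def)

lemma weight_filt_scale: "f \<in> weight_filt w k \<Longrightarrow> gscale c f \<in> weight_filt w k"
  by (simp add: weight_filt_def)

lemma weight_filt_add: "f \<in> weight_filt w k \<Longrightarrow> g \<in> weight_filt w k \<Longrightarrow> f + g \<in> weight_filt w k"
  unfolding weight_filt_def by simp (metis add_0)

lemma weight_filt_minus: "f \<in> weight_filt w k \<Longrightarrow> - f \<in> weight_filt w k"
  by (simp add: weight_filt_def)

lemma weight_filt_diff: "f \<in> weight_filt w k \<Longrightarrow> g \<in> weight_filt w k \<Longrightarrow> f - g \<in> weight_filt w k"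
  using weight_filt_add[OF _ weight_filt_minus] by fastforce

lemma weight_filt_sum: "(\<And>x. x \<in> A \<Longrightarrow> h x \<in> weight_filt w k) \<Longrightarrow> sum h A \<in> weight_filt w k"
  by (induction A rule: infinite_finite_induct) (auto intro: weight_filt_0 weight_filt_add)

lemma weight_filt_sign: "f \<in> weight_filt w k \<Longrightarrow> (- 1) ^ n * f \<in> weight_filt w k"
  by (cases "even n") (auto intro: weight_filt_minus)

lemma weight_filt_mono: "f \<in> weight_filt w k \<Longrightarrow> l \<le> k \<Longrightarrow> f \<in> weight_filt w l"
  unfolding weight_filt_def by fastforce

lemma weight_filt_mult:
  assumes "f \<in> weight_filt w k" "g \<in> weight_filt w l"
  shows "f * g \<in> weight_filt w (k + l)"
  unfolding weight_filt_def
proof clarify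
  fix U assume "coeff (f * g) U \<noteq> 0"
  then show "k + l \<le> sum w U"
  proof (rule coeff_times_nonzeroE)
    fix S T assume "U = S \<union> T" "S \<inter> T = {}" "finite S" "finite T" "coeff f S \<noteq> 0" "coeff g T \<noteq> 0"
    then show ?thesis
      using assms by (simp add: weight_filt_def sum.union_disjoint add_mono)
  qed
qed

lemma gen_in_weight_filt: "gen i \<in> weight_filt w (w i)"
  by (simp add: weight_filt_def coeff_gen)

lemma gmon_in_weight_filt: "gmon S \<in> weight_filt w (sum w S)"
  by (simp add: weight_filt_def coeff_gmon)

lemma one_in_weight_filt: "1 \<in> weight_filt w 0"
  by (simp add: weight_filt_def one_grassmann.rep_eq)

lemma prod_gen_in_weight_filt: "prod_list (map gen xs) \<in> weight_filt w (sum_list (map w xs))"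
  by (induction xs) (simp_all add: one_in_weight_filt weight_filt_mult gen_in_weight_filt)

section \<open>The Grassmann subalgebras on the generators before the k-th\<close>

definition below :: "nat \<Rightarrow> 'a::field grassmann set" where
  "below k = {f. \<forall>S. coeff f S \<noteq> 0 \<longrightarrow> S \<subseteq> {..<k}}"

lemma below_0: "0 \<in> below k"
  by (simp add: below_def)

lemma below_1: "1 \<in> below k"
  by (simp add: below_def one_grassmann.rep_eq)

lemma below_scale: "f \<in> below k \<Longrightarrow> gscale c f \<in> below k"
  by (simp add: below_def)

lemma below_add: "f \<in> below k \<Longrightarrow> g \<in> below k \<Longrightarrow> f + g \<in> below k"
  unfolding below_def by simp (metis add_0)

lemma below_minus: "f \<in> below k \<Longrightarrow> - f \<in> below k"
  by (simp add: below_def)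

lemma below_diff: "f \<in> below k \<Longrightarrow> g \<in> below k \<Longrightarrow> f - g \<in> below k"
  using below_add[OF _ below_minus] by fastforce

lemma below_sum: "(\<And>x. x \<in> A \<Longrightarrow> h x \<in> below k) \<Longrightarrow> sum h A \<in> below k"
  by (induction A rule: infinite_finite_induct) (auto intro: below_0 below_add)

lemma below_sign: "f \<in> below k \<Longrightarrow> (- 1) ^ n * f \<in> below k"
  by (cases "even n") (auto intro: below_minus)

lemma below_mult:
  assumes "f \<in> below k" "g \<in> below k"
  shows "f * g \<in> below k"
  unfolding below_def
proof clarify
  fix U x assume "coeff (f * g) U \<noteq> 0" "x \<in> U"
  then show "x < k"
    using assms by (elim coeff_times_nonzeroE) (auto simp: below_def)
qed

lemma prod_gen_in_below: "set xs \<subseteq> {..<k} \<Longrightarrow> prod_list (map gen xs) \<in> (below k :: 'a::field grassmann set)"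
proof (induction xs)
  case (Cons i xs)
  moreover from Cons.prems have "gen i \<in> (below k :: 'a grassmann set)"
    by (simp add: below_def coeff_gen)
  ultimately show ?case by (simp add: below_mult)
qed (simp add: below_1)

lemma gderiv_in_below: "f \<in> below k \<Longrightarrow> gderiv i f \<in> below k"
  by (auto simp: below_def coeff_gderiv split: if_splits)

lemma gderiv_below_eq_0:
  assumes "f \<in> below k" "k \<le> i"
  shows "gderiv i f = 0"
proof (rule grassmann_eqI)
  fix T :: "nat set"
  have "coeff f (insert i T) = 0" using assms by (force simp: below_def)
  then show "coeff (gderiv i f) T = coeff 0 T" by (simp add: coeff_gderiv)
qed

section \<open>Superderivations\<close>

lemma gr_comp_minus: "f \<in> gr_comp d \<Longrightarrow> - f \<in> gr_comp d"
  by (simp add: gr_comp_def)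

lemma gr_comp_scale: "f \<in> gr_comp d \<Longrightarrow> gscale c f \<in> gr_comp d"
  by (simp add: gr_comp_def)

lemma gr_comp_sign: "f \<in> gr_comp d \<Longrightarrow> (- 1) ^ n * f \<in> gr_comp d"
  by (cases "even n") (auto intro: gr_comp_minus)

lemma gr_comp_diff: "f \<in> gr_comp d \<Longrightarrow> g \<in> gr_comp d \<Longrightarrow> f - g \<in> gr_comp d"
  using gr_comp_add[OF _ gr_comp_minus] by fastforce

lemma gr_comp_sum: "(\<And>x. x \<in> A \<Longrightarrow> h x \<in> gr_comp d) \<Longrightarrow> sum h A \<in> gr_comp d"
  by (induction A rule: infinite_finite_induct) (auto intro: gr_comp_0 gr_comp_add)

lemma gr_comp_mult:
  assumes "f \<in> gr_comp d" "g \<in> gr_comp e"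
  shows "f * g \<in> gr_comp (d + e)"
  unfolding gr_comp_def
proof clarify
  fix U assume "coeff (f * g) U \<noteq> 0"
  then show "card U mod 2 = (d + e) mod 2"
  proof (rule coeff_times_nonzeroE)
    fix S T assume *: "U = S \<union> T" "S \<inter> T = {}" "finite S" "finite T" "coeff f S \<noteq> 0" "coeff g T \<noteq> 0"
    then have "card S mod 2 = d mod 2" "card T mod 2 = e mod 2"
      using assms by (auto simp: gr_comp_def)
    then show ?thesis unfolding *(1) card_Un_disjoint[OF *(3,4,2)] by (rule mod_add_cong)
  qed
qed

lemma one_in_gr_comp: "1 \<in> gr_comp 0"
  by (simp add: gr_comp_def one_grassmann.rep_eq)

lemma gen_in_gr_comp: "gen i \<in> gr_comp 1"
  by (simp add: gr_comp_def coeff_gen)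

lemma prod_gen_in_gr_comp: "prod_list (map gen xs) \<in> gr_comp (length xs)"
proof (induction xs)
  case (Cons i xs)
  show ?case using gr_comp_mult[OF gen_in_gr_comp Cons] by simp
qed (simp add: one_in_gr_comp)

text \<open>Passing two generators across a third changes the sign twice. Induction carries this to
  monomials, and the monomial expansion to every \<open>f\<close>.\<close>

lemma gen_gen_central: "gen i * gen j * f = f * (gen i * gen j :: 'a::field grassmann)"
proof -
  have mon: "gen i * gen j * gmon S = gmon S * (gen i * gen j :: 'a grassmann)" if "finite S" for S
    using that
  proof (induction S)
    case empty
    then show ?case by (simp add: gmon_empty)
  next
    case (insert k S)
    have "gen i * gen j * gen k = - (gen i * gen k * gen j :: 'a grassmann)"
      unfolding mult.assoc gen_anticommute[of j k] by simp
    also have "\<dots> = gen k * gen i * gen j"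
      unfolding gen_anticommute[of i k] by simp
    finally have "gen i * gen j * (gen k * gmon S) = gen k * (gen i * gen j * gmon S :: 'a grassmann)"
      by (simp add: mult.assoc[symmetric])
    also have "\<dots> = gen k * gmon S * (gen i * gen j)"
      unfolding insert.IH by (simp add: mult.assoc)
    finally show ?case using insert.hyps by (simp add: gmon_insert)
  qed
  have "gen i * gen j * (\<Sum>S | coeff f S \<noteq> 0. gscale (coeff f S) (gmon S)) =
      (\<Sum>S | coeff f S \<noteq> 0. gscale (coeff f S) (gmon S)) * (gen i * gen j)"
    unfolding sum_distrib_left sum_distrib_right
  proof (rule sum.cong[OF refl])
    fix S assume "S \<in> {S. coeff f S \<noteq> 0}"
    then have "finite S" using coeff_infinite[of S f] by blast
    then show "gen i * gen j * gscale (coeff f S) (gmon S) =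
        gscale (coeff f S) (gmon S) * (gen i * gen j)"
      using mon by simp
  qed
  then show ?thesis unfolding grassmann_expansion[symmetric] .
qed

lemma prod_gen_central: "even (length xs) \<Longrightarrow> prod_list (map gen xs) * f = f * prod_list (map gen xs)"
proof (induction xs rule: induct_list012)
  case (3 i j xs)
  then have IH: "prod_list (map gen xs) * f = f * prod_list (map gen xs)" by simp
  have "prod_list (map gen (i # j # xs)) * f = gen i * gen j * (prod_list (map gen xs) * f)"
    by (simp add: mult.assoc)
  also have "\<dots> = gen i * gen j * f * prod_list (map gen xs)"
    unfolding IH by (simp add: mult.assoc)
  also have "\<dots> = f * prod_list (map gen (i # j # xs))"
    unfolding gen_gen_central by (simp add: mult.assoc)
  finally show ?case .
qed simp_all

text \<open>Only the class of \<open>d\<close> modulo 2 matters, see \<open>tame_cong\<close>. The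
  first factor is homogeneous because the Leibniz sign depends on its degree.\<close>

definition superderivation :: "nat \<Rightarrow> 'a::field endo \<Rightarrow> bool" where
  "superderivation d a \<longleftrightarrow> a \<in> endo_comp d \<and>
    (\<forall>e. \<forall>f\<in>gr_comp e. \<forall>g. app a (f * g) = app a f * g + (- 1) ^ (d * e) * f * app a g)"

lemma superderivationD:
  assumes "superderivation d a"
  shows "f \<in> gr_comp e \<Longrightarrow> app a f \<in> gr_comp (d + e)"
    and "f \<in> gr_comp e \<Longrightarrow> app a (f * g) = app a f * g + (- 1) ^ (d * e) * f * app a g"
  using assms unfolding superderivation_def endo_comp_def by blast+

lemma app_sign: "app a ((- 1) ^ n * f) = (- 1) ^ n * app a f"
proof -
  have "app a (- g) = - app a g" for g
    using app_add[of a g "- g"] by (simp add: eq_neg_iff_add_eq_0 add.commute)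
  then show ?thesis by (cases "even n") simp_all
qed

lemma sign_left_commute: "f * ((- 1) ^ n * g) = (- 1) ^ n * (f * g :: 'b::ring_1)"
  by (cases "even n") simp_all

lemma superderivation_one:
  assumes "superderivation d a"
  shows "app a 1 = 0"
  using superderivationD(2)[OF assms one_in_gr_comp, of 1] by simp

lemma app_scomm:
  "app (a * b - (- 1) ^ n * b * a) f = app a (app b f) - (- 1) ^ n * app b (app a f)"
  by (cases "even n") simp_all

text \<open>Expanding both compositions on \<open>f * g\<close> leaves mixed terms, with one
  operator on each factor. Their signs agree after multiplication by \<open>(- 1) ^ (d * e)\<close>,
  so they cancel.\<close>

lemma superderivation_scomm:
  assumes a: "superderivation d a" and b: "superderivation e b"
  shows "superderivation (d + e) (a * b - (- 1) ^ (d * e) * b * a)"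
  unfolding superderivation_def endo_comp_def
proof (intro conjI CollectI allI ballI)
  fix l and f :: "'a grassmann" assume f: "f \<in> gr_comp l"
  have "app a (app b f) \<in> gr_comp (d + (e + l))" "app b (app a f) \<in> gr_comp (e + (d + l))"
    using superderivationD(1)[OF a] superderivationD(1)[OF b] f by blast+
  then show "app (a * b - (- 1) ^ (d * e) * b * a) f \<in> gr_comp (d + e + l)"
    unfolding app_scomm by (intro gr_comp_diff gr_comp_sign) (simp_all only: ac_simps)
  fix g
  note D = superderivationD[OF a] superderivationD[OF b]
  have ab: "app a (app b (f * g)) = app a (app b f) * g + (- 1) ^ (d * (e + l)) * app b f * app a g +
      (- 1) ^ (e * l) * (app a f * app b g + (- 1) ^ (d * l) * f * app a (app b g))"
    unfolding D(4)[OF f] app_add D(2)[OF D(3)[OF f]] mult.assoc app_sign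
    unfolding D(2)[OF f] by (simp add: mult.assoc)
  have ba: "app b (app a (f * g)) = app b (app a f) * g +
      (- 1) ^ (e * (d + l)) * app a f * app b g +
      (- 1) ^ (d * l) * (app b f * app a g + (- 1) ^ (e * l) * f * app b (app a g))"
    unfolding D(2)[OF f] app_add D(4)[OF D(1)[OF f]] mult.assoc app_sign
    unfolding D(4)[OF f] by (simp add: mult.assoc)
  show "app (a * b - (- 1) ^ (d * e) * b * a) (f * g) =
      app (a * b - (- 1) ^ (d * e) * b * a) f * g +
      (- 1) ^ ((d + e) * l) * f * app (a * b - (- 1) ^ (d * e) * b * a) g"
    unfolding app_scomm ab ba
    by (cases "even d"; cases "even e"; cases "even l") (simp_all add: algebra_simps)
qed

text \<open>The two mixed terms carry opposite signs and cancel without division by 2. This serves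
  both the squaring operation in characteristic 2 and the odd case of the theorem.\<close>

lemma superderivation_square:
  assumes a: "superderivation 1 a"
  shows "superderivation 0 (a * a)"
  unfolding superderivation_def endo_comp_def
proof (intro conjI CollectI allI ballI)
  fix l and f :: "'a grassmann" assume f: "f \<in> gr_comp l"
  note D = superderivationD[OF a]
  have "app a (app a f) \<in> gr_comp (1 + (1 + l))"
    using D(1) f by blast
  moreover have "gr_comp (1 + (1 + l)) = (gr_comp l :: 'a grassmann set)"
    by (rule gr_comp_cong) simp
  ultimately show "app (a * a) f \<in> gr_comp (0 + l)" by simp
  fix g
  have "app a (app a (f * g)) = app a (app a f) * g + (- 1) ^ (1 * (1 + l)) * app a f * app a g +
      (- 1) ^ (1 * l) * (app a f * app a g + (- 1) ^ (1 * l) * f * app a (app a g))"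
    unfolding D(2)[OF f] app_add D(2)[OF D(1)[OF f]] mult.assoc app_sign
    unfolding D(2)[OF f] by (simp add: mult.assoc)
  then show "app (a * a) (f * g) = app (a * a) f * g + (- 1) ^ (0 * l) * f * app (a * a) g"
    by (cases "even l") (simp_all add: algebra_simps)
qed

text \<open>By the Leibniz rule a superderivation replaces one generator of a monomial at a time, so
  a weight shift on generators is a weight shift everywhere.\<close>

lemma superderivation_weight_filt:
  assumes a: "superderivation d a"
    and gen: "\<And>i. app a (gen i) \<in> weight_filt w (w i + m)"
    and f: "f \<in> weight_filt w k"
  shows "app a f \<in> weight_filt w (k + m)"
proof -
  have mon: "app a (gmon S) \<in> weight_filt w (sum w S + m)" if "finite S" for S
    using that
  proof (induction S)
    case empty
    then show ?case by (simp add: gmon_empty superderivation_one[OF a] weight_filt_0)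
  next
    case (insert i S)
    have "app a (gen i) * gmon S \<in> weight_filt w ((w i + m) + sum w S)"
      by (intro weight_filt_mult gen gmon_in_weight_filt)
    moreover have "gen i * app a (gmon S) \<in> weight_filt w (w i + (sum w S + m))"
      by (intro weight_filt_mult insert.IH gen_in_weight_filt)
    ultimately show ?case
      using insert.hyps
      by (simp add: gmon_insert superderivationD(2)[OF a gen_in_gr_comp] mult.assoc algebra_simps
          weight_filt_scale weight_filt_add weight_filt_sign)
  qed
  have app_sum: "app a (sum h A) = (\<Sum>x\<in>A. app a (h x))" for h and A :: "nat set set"
    by (induction A rule: infinite_finite_induct) simp_all
  have "app a (\<Sum>S | coeff f S \<noteq> 0. gscale (coeff f S) (gmon S)) \<in> weight_filt w (k + m)"
    unfolding app_sum
  proof (rule weight_filt_sum)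
    fix S assume "S \<in> {S. coeff f S \<noteq> 0}"
    then have "finite S" "k \<le> sum w S"
      using coeff_infinite[of S f] f by (auto simp: weight_filt_def)
    then show "app a (gscale (coeff f S) (gmon S)) \<in> weight_filt w (k + m)"
      using weight_filt_mono[OF mon] by (simp add: weight_filt_scale)
  qed
  then show ?thesis unfolding grassmann_expansion[symmetric] .
qed

section \<open>A Lie superalgebra of triangular superderivations\<close>

text \<open>This counts the letters \<open>gen i\<close> with \<open>i < N\<close> in a monomial.
  For \<open>m \<ge> 0\<close> the filtration step \<open>m\<close> is thus the m-th power of the
  ideal they generate.\<close>

abbreviation head_weight :: "nat \<Rightarrow> nat \<Rightarrow> int" where
  "head_weight N \<equiv> \<lambda>i. if i < N then 1 else 0"

lemma weight_filt_head_nonpos: "m \<le> 0 \<Longrightarrow> weight_filt (head_weight N) m = UNIV"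
proof -
  assume m: "m \<le> 0"
  have "m \<le> sum (head_weight N) S" for S
    by (rule order_trans[OF m sum_nonneg]) simp
  then show ?thesis unfolding weight_filt_def by blast
qed

text \<open>At most one letter with index below \<open>N\<close> is destroyed: every generator loses
  at most weight 1, since its image has weight at least 0.\<close>

lemma superderivation_head_weight:
  assumes "superderivation d a" "f \<in> weight_filt (head_weight N) (m + 1)"
  shows "app a f \<in> weight_filt (head_weight N) m"
proof -
  have "app a (gen i) \<in> weight_filt (head_weight N) (head_weight N i + - 1)" for i
    by (subst weight_filt_head_nonpos) simp_all
  from superderivation_weight_filt[OF assms(1) this assms(2)] show ?thesis by simp
qed

text \<open>Invariance of \<open>below k\<close> lets triangularity pass to compositions. All
  \<open>m\<close> are demanded at once because a composition gives up one power of the ideal. The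
  threshold \<open>N0\<close> may depend on \<open>m\<close>.\<close>

definition tame :: "nat \<Rightarrow> 'a::field endo set" where
  "tame d = {a. superderivation d a \<and>
    (\<forall>k. \<forall>f\<in>below k. app a f \<in> below k) \<and>
    (\<forall>k. app a (gen k) \<in> below k) \<and>
    (\<forall>m. \<exists>N0. \<forall>N\<ge>N0. \<forall>k\<ge>N. app a (gen k) \<in> weight_filt (head_weight N) m)}"

lemma tameI:
  assumes "superderivation d a"
    and "\<And>k f. f \<in> below k \<Longrightarrow> app a f \<in> below k"
    and "\<And>k. app a (gen k) \<in> below k"
    and "\<And>m. \<exists>N0. \<forall>N\<ge>N0. \<forall>k\<ge>N. app a (gen k) \<in> weight_filt (head_weight N) m"
  shows "a \<in> tame d"
  using assms unfolding tame_def by blast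

lemma tameD:
  assumes "a \<in> tame d"
  shows "superderivation d a"
    and "f \<in> below k \<Longrightarrow> app a f \<in> below k"
    and "app a (gen k) \<in> below k"
    and "\<exists>N0. \<forall>N\<ge>N0. \<forall>k\<ge>N. app a (gen k) \<in> weight_filt (head_weight N) m"
  using assms unfolding tame_def by blast+

lemma tame_endo_comp: "a \<in> tame d \<Longrightarrow> a \<in> endo_comp d"
  using tameD(1) unfolding superderivation_def by blast

text \<open>A composition is in general no superderivation, but it keeps the other properties;
  brackets and squares both inherit them from here.\<close>

lemma tame_mult:
  assumes a: "a \<in> tame d" and b: "b \<in> tame e"
  shows "f \<in> below k \<Longrightarrow> app (a * b) f \<in> below k"
    and "app (a * b) (gen k) \<in> below k"
    and "\<exists>N0. \<forall>N\<ge>N0. \<forall>k\<ge>N. app (a * b) (gen k) \<in> weight_filt (head_weight N) m"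
proof -
  show "f \<in> below k \<Longrightarrow> app (a * b) f \<in> below k" "app (a * b) (gen k) \<in> below k"
    using tameD[OF a] tameD[OF b] by simp_all
  show "\<exists>N0. \<forall>N\<ge>N0. \<forall>k\<ge>N. app (a * b) (gen k) \<in> weight_filt (head_weight N) m"
    \<comment> \<open>The spare power in \<open>m + 1\<close> pays for the one that \<open>a\<close>
      may lose.\<close>
    using tameD(4)[OF b, of "m + 1"] superderivation_head_weight[OF tameD(1)[OF a]] by fastforce
qed

lemma tame_lincomb:
  assumes a: "a \<in> tame d" and b: "b \<in> tame d"
  shows "escale s a + escale t b \<in> tame d"
proof (rule tameI)
  note D = superderivationD[OF tameD(1)[OF a]] superderivationD[OF tameD(1)[OF b]]
  show "superderivation d (escale s a + escale t b)"
  unfolding superderivation_def endo_comp_def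
  proof (intro conjI CollectI allI ballI)
    fix e and f g :: "'a grassmann" assume f: "f \<in> gr_comp e"
    show "app (escale s a + escale t b) f \<in> gr_comp (d + e)"
      using D(1,3) f by (auto intro!: gr_comp_add gr_comp_scale)
    show "app (escale s a + escale t b) (f * g) = app (escale s a + escale t b) f * g +
        (- 1) ^ (d * e) * f * app (escale s a + escale t b) g"
      by (simp add: D(2,4)[OF f] gr.scale_right_distrib algebra_simps)
  qed
next
  fix m
  obtain M N where "\<forall>n\<ge>M. \<forall>k\<ge>n. app a (gen k) \<in> weight_filt (head_weight n) m"
    "\<forall>n\<ge>N. \<forall>k\<ge>n. app b (gen k) \<in> weight_filt (head_weight n) m"
    using tameD(4)[OF a] tameD(4)[OF b] by blast
  then show "\<exists>N0. \<forall>N\<ge>N0. \<forall>k\<ge>N. app (escale s a + escale t b) (gen k)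
      \<in> weight_filt (head_weight N) m"
    by (intro exI[of _ "max M N"]) (auto intro!: weight_filt_add weight_filt_scale)
qed (use tameD[OF a] tameD[OF b] in \<open>auto intro!: below_add below_scale\<close>)

lemma tame_0: "0 \<in> tame d"
  by (rule tameI)
    (simp_all add: superderivation_def endo_comp_def gr_comp_0 below_0 weight_filt_0)

lemma tame_add: "a \<in> tame d \<Longrightarrow> b \<in> tame d \<Longrightarrow> a + b \<in> tame d"
  using tame_lincomb[of a d b 1 1] by simp

lemma tame_scale: "a \<in> tame d \<Longrightarrow> escale s a \<in> tame d"
  using tame_lincomb[OF _ tame_0, of a d s 0] by simp

lemma tame_scomm:
  assumes a: "a \<in> tame d" and b: "b \<in> tame e"
  shows "a * b - (- 1) ^ (d * e) * b * a \<in> tame (d + e)"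
proof (rule tameI)
  show "superderivation (d + e) (a * b - (- 1) ^ (d * e) * b * a)"
    using a b by (intro superderivation_scomm tameD(1))
  note ab = tame_mult[OF a b, simplified app_simps] tame_mult[OF b a, simplified app_simps]
  show "app (a * b - (- 1) ^ (d * e) * b * a) f \<in> below k" if "f \<in> below k" for f k
    unfolding app_scomm using ab that by (intro below_diff below_sign)
  show "app (a * b - (- 1) ^ (d * e) * b * a) (gen k) \<in> below k" for k
    unfolding app_scomm using ab by (intro below_diff below_sign)
  fix m
  obtain M N where "\<forall>n\<ge>M. \<forall>k\<ge>n. app a (app b (gen k)) \<in> weight_filt (head_weight n) m"
    "\<forall>n\<ge>N. \<forall>k\<ge>n. app b (app a (gen k)) \<in> weight_filt (head_weight n) m"
    using ab(3) ab(6) by blast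
  then show "\<exists>N0. \<forall>N\<ge>N0. \<forall>k\<ge>N. app (a * b - (- 1) ^ (d * e) * b * a) (gen k)
      \<in> weight_filt (head_weight N) m"
    unfolding app_scomm by (intro exI[of _ "max M N"]) (auto intro!: weight_filt_diff weight_filt_sign)
qed

lemma tame_square:
  assumes a: "a \<in> tame 1"
  shows "a * a \<in> tame 0"
proof (rule tameI)
  show "superderivation 0 (a * a)" by (rule superderivation_square[OF tameD(1)[OF a]])
qed (rule tame_mult[OF a a], assumption?)+

text \<open>Degrees add under the bracket, so two odd operators give degree 2; this brings the
  degree back to 0 or 1.\<close>

lemma tame_cong: "d mod 2 = e mod 2 \<Longrightarrow> tame d = tame e"
proof -
  assume de: "d mod 2 = e mod 2"
  then have "even d \<longleftrightarrow> even e" by presburger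
  then have "(- 1) ^ (d * l) = ((- 1) ^ (e * l) :: 'a grassmann)" for l
    by (simp add: minus_one_power_iff)
  moreover have "gr_comp (d + l) = (gr_comp (e + l) :: 'a grassmann set)" for l
    using de by (intro gr_comp_cong mod_add_cong refl)
  ultimately have "superderivation d (a :: 'a endo) \<longleftrightarrow> superderivation e a" for a
    by (simp add: superderivation_def endo_comp_def)
  then show ?thesis by (simp add: tame_def)
qed

section \<open>The Lie superalgebra formed by the tame operators\<close>

text \<open>The direct sum of the even and the odd tame operators, phrased through the projections
  so that being graded is immediate. Minimality of \<open>Lie\<close> is applied to this
  set.\<close>

definition tame_algebra :: "'a::field endo set" where
  "tame_algebra = {a. endo_part 0 a \<in> tame 0 \<and> endo_part 1 a \<in> tame 1}"

lemma endo_part_0: "endo_part d 0 = 0"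
  by (rule endo_eqI) (simp add: endo_part.rep_eq)

lemma endo_part_scale: "endo_part d (escale c a) = escale c (endo_part d a)"
  by (rule endo_eqI) (simp add: endo_part.rep_eq gr.scale_right_distrib)

lemma tame_subset_algebra:
  assumes "a \<in> tame d"
  shows "a \<in> tame_algebra"
proof -
  have "endo_part e a \<in> tame e" for e
    using assms tame_0 tame_cong[of d e]
    by (auto simp: endo_part_homogeneous[OF tame_endo_comp[OF assms]])
  then show ?thesis by (simp add: tame_algebra_def)
qed

lemma tame_algebra_homogeneous:
  assumes "a \<in> tame_algebra" "a \<in> endo_comp d" "d \<in> {0, 1}"
  shows "a \<in> tame d"
  using assms endo_part_homogeneous[OF assms(2), of d] by (auto simp: tame_algebra_def)

lemma tame_algebra_add: "a \<in> tame_algebra \<Longrightarrow> b \<in> tame_algebra \<Longrightarrow> a + b \<in> tame_algebra"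
  by (simp add: tame_algebra_def endo_part_add tame_add)

lemma lie_subsuperalgebra_tame: "lie_subsuperalgebra (tame_algebra :: 'a::field endo set)"
  unfolding lie_subsuperalgebra_def graded_subspace_iff
proof (intro conjI ballI impI)
  show "en.subspace (tame_algebra :: 'a endo set)"
    unfolding en.subspace_def tame_algebra_def
    by (auto simp: endo_part_0 endo_part_add endo_part_scale tame_0 tame_add tame_scale)
  fix a :: "'a endo" assume a: "a \<in> tame_algebra"
  have pa: "endo_part d a \<in> tame d" if "d \<in> {0, 1}" for d
    using a that by (auto simp: tame_algebra_def)
  show "endo_part 0 a \<in> tame_algebra" "endo_part 1 a \<in> tame_algebra"
    using pa by (auto intro: tame_subset_algebra)
  fix b :: "'a endo" assume b: "b \<in> tame_algebra"
  have pb: "endo_part d b \<in> tame d" if "d \<in> {0, 1}" for d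
    using b that by (auto simp: tame_algebra_def)
  have br: "endo_part d a * endo_part e b - (- 1) ^ (d * e) * endo_part e b * endo_part d a
      \<in> tame_algebra" if "d \<in> {0, 1}" "e \<in> {0, 1}" for d e
    by (rule tame_subset_algebra[OF tame_scomm[OF pa[OF that(1)] pb[OF that(2)]]])
  have cl: "sum h {0, 1} \<in> tame_algebra" if "\<And>x. x \<in> {0, 1} \<Longrightarrow> h x \<in> tame_algebra"
    for h :: "nat \<Rightarrow> 'a endo"
    using that[of 0] that[of 1] tame_algebra_add[of "h 0" "h 1"] by simp
  show "scomm a b \<in> tame_algebra"
    unfolding scomm_def by (intro cl br)
next
  fix a :: "'a endo" assume "a \<in> tame_algebra \<inter> endo_comp 1"
  then have "a \<in> tame 1" using tame_algebra_homogeneous by blast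
  then show "a * a \<in> tame_algebra" by (rule tame_subset_algebra[OF tame_square])
qed

section \<open>The pivot elements\<close>

text \<open>In each summand the monomial before the derivative has even length, so it is even and
  central, and multiplying \<open>gderiv\<close> by it preserves the odd Leibniz rule.\<close>

lemma superderivation_pivot: "superderivation 1 (pivot i)"
  unfolding superderivation_def endo_comp_def
proof (intro conjI CollectI allI ballI)
  fix e and f :: "'a grassmann" assume f: "f \<in> gr_comp e"
  let ?P = "\<lambda>k. prod_list (map gen [i..<i + 2 * k]) :: 'a grassmann"
  have "?P k \<in> gr_comp (2 * k)" for k
    using prod_gen_in_gr_comp[of "[i..<i + 2 * k]", where 'a = 'a] by simp
  then have "?P k * gderiv (i + 2 * k) f \<in> gr_comp (2 * k + (e + 1))" for k
    using f by (intro gr_comp_mult gderiv_parity)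
  moreover have "gr_comp (2 * k + (e + 1)) = (gr_comp (1 + e) :: 'a grassmann set)" for k
    by (rule gr_comp_cong) simp
  ultimately show "app (pivot i) f \<in> gr_comp (1 + e)"
    unfolding pivot.rep_eq pivot_fun_def by (intro gr_comp_sum) blast
  fix g :: "'a grassmann"
  obtain L where L: "\<forall>j\<ge>L. gderiv j f = 0" using gderiv_eventually_0 by blast
  obtain M where M: "\<forall>j\<ge>M. gderiv j g = 0" using gderiv_eventually_0 by blast
  obtain N where N: "\<forall>j\<ge>N. gderiv j (f * g) = 0" using gderiv_eventually_0 by blast
  \<comment> \<open>A common bound makes the three pivot sums run over the same finite
    range.\<close>
  have eq: "\<forall>j\<ge>L + M + N. gderiv j f = 0" "\<forall>j\<ge>L + M + N. gderiv j g = 0"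
    "\<forall>j\<ge>L + M + N. gderiv j (f * g) = 0"
    using L M N by simp_all
  have "?P k * f = f * ?P k" for k
    by (rule prod_gen_central) simp
  then have "?P k * (f * h) = f * (?P k * h)" for k h
    by (simp add: mult.assoc[symmetric])
  then have "?P k * gderiv (i + 2 * k) (f * g) =
      ?P k * gderiv (i + 2 * k) f * g + (- 1) ^ e * f * (?P k * gderiv (i + 2 * k) g)" for k
    by (simp only: gderiv_mult[OF f] distrib_left mult.assoc sign_left_commute)
  then show "app (pivot i) (f * g) = app (pivot i) f * g + (- 1) ^ (1 * e) * f * app (pivot i) g"
    unfolding pivot.rep_eq eq[THEN pivot_fun_eq]
    by (simp add: sum.distrib sum_distrib_left sum_distrib_right)
qed

text \<open>Only the summand containing the derivative by \<open>gen k\<close> survives. The guard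
  \<open>i \<le> k\<close> is there because \<open>k - i\<close> truncates to the even number
  0.\<close>

lemma pivot_gen:
  "app (pivot i) (gen k) =
    (if i \<le> k \<and> even (k - i) then prod_list (map gen [i..<k]) else (0 :: 'a::field grassmann))"
proof -
  have "(1 :: 'a grassmann) \<noteq> 0" by simp
  then have supp: "{j. gderiv (i + 2 * j) (gen k :: 'a grassmann) \<noteq> 0} = {j. i + 2 * j = k}"
    by (auto simp: gderiv_gen)
  show ?thesis
  proof (cases "i \<le> k \<and> even (k - i)")
    case True
    then obtain l where k: "k = i + 2 * l" by (metis dvdE le_add_diff_inverse)
    then have "{j. i + 2 * j = k} = {l}" by auto
    then show ?thesis
      using k unfolding pivot.rep_eq pivot_fun_def supp by (simp add: gderiv_gen)
  next
    case False
    then have "{j. i + 2 * j = k} = {}" by auto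
    then show ?thesis
      using False unfolding pivot.rep_eq pivot_fun_def supp by auto
  qed
qed

lemma pivot_tame: "pivot i \<in> tame 1"
proof (rule tameI[OF superderivation_pivot])
  fix k and f :: "'a grassmann" assume f: "f \<in> below k"
  have "prod_list (map gen [i..<i + 2 * j]) * gderiv (i + 2 * j) f \<in> below k" for j
  proof (cases "i + 2 * j < k")
    case True
    then show ?thesis using f by (intro below_mult prod_gen_in_below gderiv_in_below) auto
  next
    case False
    then show ?thesis using gderiv_below_eq_0[OF f] by (simp add: below_0)
  qed
  then show "app (pivot i) f \<in> below k"
    unfolding pivot.rep_eq pivot_fun_def by (intro below_sum)
next
  fix k
  show "app (pivot i) (gen k) \<in> below k"
    by (auto simp: pivot_gen below_0 intro!: prod_gen_in_below)
next
  fix m :: int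
  \<comment> \<open>The word from \<open>i\<close> to \<open>k - 1\<close> contains all indices from
    \<open>i\<close> to \<open>N - 1\<close>, and there are at least \<open>m\<close> of
    these.\<close>
  have "m \<le> sum_list (map (head_weight N) [i..<k])" if "N \<ge> i + nat m" "k \<ge> N" for N k
  proof -
    have "m \<le> (\<Sum>j\<in>{i..<N}. head_weight N j)" using that by simp
    also have "\<dots> \<le> (\<Sum>j\<in>{i..<k}. head_weight N j)"
      using that by (intro sum_mono2) auto
    finally show ?thesis by (simp add: interv_sum_list_conv_sum_set_nat)
  qed
  then have "app (pivot i) (gen k) \<in> weight_filt (head_weight N) m"
    if "N \<ge> i + nat m" "k \<ge> N" for N k
    using weight_filt_mono[OF prod_gen_in_weight_filt] that
    unfolding pivot_gen by (simp only: weight_filt_0 split: if_split) blast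
  then have "\<forall>N\<ge>i + nat m. \<forall>k\<ge>N. app (pivot i) (gen k) \<in> weight_filt (head_weight N) m"
    by blast
  then show "\<exists>N0. \<forall>N\<ge>N0. \<forall>k\<ge>N. app (pivot i) (gen k) \<in> weight_filt (head_weight N) m" ..
qed

section \<open>Nilpotency\<close>

lemma tame_even_nilpotent:
  fixes a :: "'a::field endo"
  assumes a: "a \<in> tame 0"
  shows "\<exists>L. a ^ L = 0"
proof -
  obtain N where N: "\<And>k. k \<ge> N \<Longrightarrow> app a (gen k) \<in> weight_filt (head_weight N) 1"
    using tameD(4)[OF a] by blast
  \<comment> \<open>Truncated subtraction gives weight 0 to all generators from \<open>N\<close>
    on.\<close>
  define w :: "nat \<Rightarrow> int" where "w i = int (N - i)" for i
  have w0: "0 \<le> w i" for i by (simp add: w_def)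
  have gen: "app a (gen i) \<in> weight_filt w (w i + 1)" for i
    unfolding weight_filt_def
  proof clarify
    fix S assume S: "coeff (app a (gen i)) S \<noteq> 0"
    then have fin: "finite S" using coeff_infinite by blast
    \<comment> \<open>One heavier letter suffices, as the others have nonnegative weight.\<close>
    have "\<exists>s\<in>S. w i + 1 \<le> w s"
    proof (cases "i < N")
      case True
      have "app a (gen i) \<in> gr_comp (0 + 1)"
        using superderivationD(1)[OF tameD(1)[OF a] gen_in_gr_comp] .
      \<comment> \<open>Odd parity makes \<open>S\<close> nonempty, and by triangularity each of its
        letters precedes \<open>i\<close>, so it is strictly heavier.\<close>
      then have "card S mod 2 = 1" using S by (simp add: gr_comp_def)
      then obtain s where "s \<in> S" by fastforce
      moreover have "S \<subseteq> {..<i}" using tameD(3)[OF a, of i] S by (simp add: below_def)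
      ultimately show ?thesis using True by (intro bexI[of _ s]) (auto simp: w_def)
    next
      case False
      \<comment> \<open>Here \<open>w i = 0\<close>, and any letter with index below
        \<open>N\<close> has weight at least 1.\<close>
      then have "1 \<le> sum (head_weight N) S" using N[of i] S by (simp add: weight_filt_def)
      then have "sum (head_weight N) S \<noteq> 0" by simp
      then obtain s where "s \<in> S" "head_weight N s \<noteq> 0"
        by (rule sum.not_neutral_contains_not_neutral)
      then show ?thesis using False by (intro bexI[of _ s]) (auto simp: w_def split: if_splits)
    qed
    then obtain s where "s \<in> S" "w i + 1 \<le> w s" by blast
    then show "w i + 1 \<le> sum w S"
      using member_le_sum[of s S w] fin w0 by fastforce
  qed
  have pow: "app (a ^ n) f \<in> weight_filt w (int n)" for n f
  proof (induction n)
    case 0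
    then show ?case by (simp add: weight_filt_def sum_nonneg w0)
  next
    case (Suc n)
    then show ?case
      using superderivation_weight_filt[OF tameD(1)[OF a] gen Suc] by (simp add: add.commute)
  qed
  \<comment> \<open>No monomial weighs more than the product of all generators before
    \<open>N\<close>; \<open>L\<close> exceeds that weight.\<close>
  define L where "L = nat (sum w {..<N}) + 1"
  have "app (a ^ L) f = 0" for f
  proof (rule grassmann_eqI)
    fix S :: "nat set" assume fin: "finite S"
    have "sum w S = sum w (S \<inter> {..<N})"
      using fin by (intro sum.mono_neutral_right) (auto simp: w_def)
    also have "\<dots> \<le> sum w {..<N}" by (intro sum_mono2) (auto simp: w0)
    finally have "\<not> int L \<le> sum w S" by (simp add: L_def)
    then show "coeff (app (a ^ L) f) S = coeff 0 S"
      using pow[of L f] by (auto simp: weight_filt_def)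
  qed
  then have "a ^ L = 0" by (intro endo_eqI) simp
  then show ?thesis ..
qed

section \<open>From nilpotent operators to nilpotent adjoint maps\<close>

text \<open>The n-fold commutator is a combination of terms \<open>c ^ i * b * c ^ j\<close> with
  \<open>i + j = n\<close>; for \<open>n = 2 * L\<close> one exponent reaches
  \<open>L\<close>.\<close>

lemma nilpotent_commutator:
  fixes c :: "'b::ring_1"
  assumes "c ^ L = 0"
  shows "((\<lambda>x. c * x - x * c) ^^ (2 * L)) b = 0"
proof -
  have big: "c ^ i = 0" if "i \<ge> L" for i
    using assms that by (metis le_add_diff_inverse mult_zero_left power_add)
  \<comment> \<open>Outer powers are included so that the induction trades commutators for exponents
    and avoids binomial coefficients.\<close>
  have "c ^ i * ((\<lambda>x. c * x - x * c) ^^ n) b * c ^ j = 0" if "i + j + n \<ge> 2 * L" for n i j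
    using that
  proof (induction n arbitrary: i j)
    case 0
    then have "i \<ge> L \<or> j \<ge> L" by linarith
    then show ?case using big by auto
  next
    case (Suc n)
    let ?x = "((\<lambda>x. c * x - x * c) ^^ n) b"
    have "c ^ i * (c * ?x - ?x * c) * c ^ j = c ^ Suc i * ?x * c ^ j - c ^ i * ?x * c ^ Suc j"
      unfolding power_Suc2[of c i] power_Suc[of c j] by (simp add: algebra_simps)
    also have "\<dots> = 0" using Suc.IH[of "Suc i" j] Suc.IH[of i "Suc j"] Suc.prems by simp
    finally show ?case by simp
  qed
  from this[of 0 0 "2 * L"] show ?thesis by simp
qed

text \<open>An even \<open>a\<close> meets both components of \<open>b\<close> with the same sign,
  so they recombine to \<open>b\<close>, homogeneous or not.\<close>

lemma scomm_even:
  assumes "a \<in> endo_comp 0"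
  shows "scomm a b = a * b - b * a"
proof -
  have "scomm a b = a * (endo_part 0 b + endo_part 1 b) - (endo_part 0 b + endo_part 1 b) * a"
    unfolding scomm_def by (simp add: endo_part_homogeneous[OF assms] algebra_simps)
  then show ?thesis unfolding endo_part_sum .
qed

lemma scomm_odd:
  assumes a: "a \<in> endo_comp 1"
  shows "scomm a b = a * b - endo_part 0 b * a + endo_part 1 b * a"
proof -
  have "scomm a b = a * (endo_part 0 b + endo_part 1 b) - endo_part 0 b * a + endo_part 1 b * a"
    unfolding scomm_def by (simp add: endo_part_homogeneous[OF a] algebra_simps)
  then show ?thesis unfolding endo_part_sum .
qed

lemma endo_comp_mult:
  assumes "a \<in> endo_comp d" "b \<in> endo_comp e"
  shows "a * b \<in> endo_comp (d + e)"
  using assms unfolding endo_comp_def by (simp add: add.assoc)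

lemma endo_part_mult_odd:
  assumes a: "a \<in> endo_comp 1"
  shows "endo_part 0 (a * b) = a * endo_part 1 b" "endo_part 1 (a * b) = a * endo_part 0 b"
    "endo_part 0 (b * a) = endo_part 1 b * a" "endo_part 1 (b * a) = endo_part 0 b * a"
proof -
  have in_comp: "a * endo_part 0 b \<in> endo_comp (1 + 0)" "a * endo_part 1 b \<in> endo_comp (1 + 1)"
    "endo_part 0 b * a \<in> endo_comp (0 + 1)" "endo_part 1 b * a \<in> endo_comp (1 + 1)"
    by (intro endo_comp_mult a endo_part_in)+
  note h = in_comp[THEN endo_part_homogeneous]
  have "a * b = a * endo_part 0 b + a * endo_part 1 b" "b * a = endo_part 0 b * a + endo_part 1 b * a"
    unfolding distrib_left[symmetric] distrib_right[symmetric] endo_part_sum by (rule refl)+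
  then have "endo_part d (a * b) = endo_part d (a * endo_part 0 b) + endo_part d (a * endo_part 1 b)"
    "endo_part d (b * a) = endo_part d (endo_part 0 b * a) + endo_part d (endo_part 1 b * a)" for d
    by (simp_all only: endo_part_add)
  then show "endo_part 0 (a * b) = a * endo_part 1 b" "endo_part 1 (a * b) = a * endo_part 0 b"
    "endo_part 0 (b * a) = endo_part 1 b * a" "endo_part 1 (b * a) = endo_part 0 b * a"
    by (simp_all add: h del: One_nat_def)
qed

text \<open>Bracketing with an odd \<open>a\<close> swaps the parities, so each component of
  \<open>b\<close> meets one commutator and one anticommutator. The terms with \<open>a\<close> on
  both sides then cancel, in every characteristic.\<close>

lemma scomm_odd_twice:
  assumes a: "a \<in> endo_comp 1"
  shows "scomm a (scomm a b) = a * a * b - b * (a * a)"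
proof -
  have parts: "scomm a b = (a * endo_part 0 b - endo_part 0 b * a) +
      (a * endo_part 1 b + endo_part 1 b * a)"
    unfolding scomm_def by (simp add: endo_part_homogeneous[OF a] algebra_simps)
  have idem: "endo_part d (endo_part e b) = (if d mod 2 = e mod 2 then endo_part e b else 0)" for d e
    by (rule endo_part_homogeneous[OF endo_part_in])
  have neg: "endo_part d (x - y) = endo_part d x - endo_part d y" for d and x y :: "'a endo"
    using endo_part_add[of d "x - y" y] by simp
  have even_part: "endo_part 0 (scomm a b) = a * endo_part 1 b + endo_part 1 b * a"
    and odd_part: "endo_part 1 (scomm a b) = a * endo_part 0 b - endo_part 0 b * a"
    unfolding parts
    by (simp_all add: endo_part_add neg endo_part_mult_odd[OF a] idem del: One_nat_def)
  have "scomm a (scomm a b) = a * a * (endo_part 0 b + endo_part 1 b) -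
      (endo_part 0 b + endo_part 1 b) * (a * a)"
    unfolding scomm_odd[OF a, of "scomm a b"] even_part odd_part
    unfolding parts by (simp add: algebra_simps)
  then show ?thesis unfolding endo_part_sum .
qed

theorem theorem12p1:
  fixes a :: "'a::field endo" and n :: nat
  assumes "n \<in> {0, 1}" and "a \<in> RR \<inter> endo_comp n"
  shows "\<exists>N. \<forall>b\<in>RR. (scomm a ^^ N) b = 0"
proof -
  have "pivot i \<in> (tame_algebra :: 'a endo set)" for i
    by (rule tame_subset_algebra[OF pivot_tame])
  then have "RR \<subseteq> (tame_algebra :: 'a endo set)"
    unfolding RR_def by (intro Lie_least lie_subsuperalgebra_tame) simp
  then have a: "a \<in> tame n" using assms tame_algebra_homogeneous by blast
  from assms(1) consider "n = 0" | "n = 1" by blast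
  then show ?thesis
  proof cases
    case 1
    then obtain L where L: "a ^ L = 0" using a tame_even_nilpotent by blast
    have "scomm a = (\<lambda>b. a * b - b * a)"
      using assms(2) 1 by (intro ext scomm_even) simp
    \<comment> \<open>The exponent depends on \<open>a\<close> alone, so it serves all
      \<open>b\<close> simultaneously.\<close>
    then have "(scomm a ^^ (2 * L)) b = 0" for b
      by (simp only: nilpotent_commutator[OF L])
    then show ?thesis by (intro exI ballI)
  next
    case 2
    then obtain L where L: "(a * a) ^ L = 0" using a tame_square tame_even_nilpotent by blast
    have sq: "scomm a ^^ 2 = (\<lambda>b. a * a * b - b * (a * a))"
      using assms(2) 2 by (intro ext) (simp add: numeral_2_eq_2 scomm_odd_twice del: One_nat_def)
    \<comment> \<open>Each commutator with \<open>a * a\<close> costs two brackets with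
      \<open>a\<close>, which doubles the exponent of the even case.\<close>
    have "(scomm a ^^ (2 * (2 * L))) b = 0" for b
      unfolding funpow_mult[where f = "scomm a" and m = 2 and n = "2 * L", symmetric] sq
      by (rule nilpotent_commutator[OF L])
    then show ?thesis by (intro exI ballI)
  qed
qed

end
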